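(* Every non-metrizable uncountable separable punctiform $\mathcal{M}_\omega$-group is homeomorphic (as a topological space) to $(2^\omega)^\infty$.
   Context: A topological group $G$ is an $\mathcal{M}_\omega$-group if its underlying topological space is an $\mathcal{M}_\omega$-space. A topological space $X$ is an $\mathcal{M}_\omega$-space if it admits a countable cover $\mathcal{K}$ by closed metrizable subspaces of $X$ such that a subset $U\subset X$ is open in $X$ if and only if $U\cap K$ is open in $K$ for every $K\in\mathcal{K}$. A topological space is punctiform if it contains no connected compact subspace having more than one point. A topological space $X$ carries the direct limit topology with respect to a tower $X_1\subset X_2\subset X_3\subset\dots$ of subsets of $X$, written $X=\varinjlim X_n$, if $X=\bigcup_{n=1}^\infty X_n$ and a subset $U\subset X$ is open if and only if $U\cap X_n$ is open in $X_n$ for every $n\in\mathbb{N}$. $2^\omega=\{0,1\}^\omega$ is the Cantor cube, and $(2^\omega)^\infty=\varinjlim (2^\omega)^n$ is the direct limit of the tower $2^\omega\subset(2^\omega)^2\subset(2^\omega)^3\subset\dots$ of its finite powers, where $(2^\omega)^n$ is identified with the subspace $(2^\omega)^n\times\{*\}$ of $(2^\omega)^{n+1}$ and $*$ is any fixed point of $2^\omega$. *)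

theory Defs
  imports "HOL-Algebra.Group" "HOL-Analysis.Analysis"
begin

definition topological_group :: "('a, 'b) monoid_scheme \<Rightarrow> 'a topology \<Rightarrow> bool" where
  "topological_group G T \<longleftrightarrow>
     group G \<and> topspace T = carrier G \<and>
     continuous_map (prod_topology T T) T (\<lambda>(x, y). x \<otimes>\<^bsub>G\<^esub> y) \<and>
     continuous_map T T (\<lambda>x. inv\<^bsub>G\<^esub> x)"

definition M_omega_space :: "'a topology \<Rightarrow> bool" where
  "M_omega_space X \<longleftrightarrow>
     (\<exists>\<K>. countable \<K> \<and> \<Union>\<K> = topspace X \<and>
        (\<forall>K\<in>\<K>. closedin X K \<and> metrizable_space (subtopology X K)) \<and>
        (\<forall>U. U \<subseteq> topspace X \<longrightarrow>
           (openin X U \<longleftrightarrow> (\<forall>K\<in>\<K>. openin (subtopology X K) (U \<inter> K)))))"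

definition M_omega_group :: "('a, 'b) monoid_scheme \<Rightarrow> 'a topology \<Rightarrow> bool" where
  "M_omega_group G T \<longleftrightarrow> topological_group G T \<and> M_omega_space T"

definition punctiform :: "'a topology \<Rightarrow> bool" where
  "punctiform X \<longleftrightarrow>
     \<not> (\<exists>C. compactin X C \<and> connectedin X C \<and> (\<exists>x\<in>C. \<exists>y\<in>C. x \<noteq> y))"

definition direct_limit_topology :: "(nat \<Rightarrow> 'a topology) \<Rightarrow> 'a topology" where
  "direct_limit_topology X =
     topology (\<lambda>U. U \<subseteq> (\<Union>n. topspace (X n)) \<and> (\<forall>n. openin (X n) (U \<inter> topspace (X n))))"

lemma openin_direct_limit_topology:
  "openin (direct_limit_topology X) U \<longleftrightarrow>
     U \<subseteq> (\<Union>n. topspace (X n)) \<and> (\<forall>n. openin (X n) (U \<inter> topspace (X n)))"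
proof -
  let ?P = "\<lambda>U. U \<subseteq> (\<Union>n. topspace (X n)) \<and> (\<forall>n. openin (X n) (U \<inter> topspace (X n)))"
  have inter: "?P (S \<inter> S')" if "?P S" "?P S'" for S S'
  proof -
    have "openin (X n) ((S \<inter> topspace (X n)) \<inter> (S' \<inter> topspace (X n)))" for n
      using that by blast
    moreover have "(S \<inter> topspace (X n)) \<inter> (S' \<inter> topspace (X n)) = S \<inter> S' \<inter> topspace (X n)" for n
      by blast
    ultimately show ?thesis using that by auto
  qed
  have union: "?P (\<Union>\<U>)" if "\<forall>S\<in>\<U>. ?P S" for \<U>
  proof -
    have "openin (X n) (\<Union>S\<in>\<U>. S \<inter> topspace (X n))" for n
      using that by blast
    moreover have "(\<Union>S\<in>\<U>. S \<inter> topspace (X n)) = \<Union>\<U> \<inter> topspace (X n)" for n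
      by blast
    ultimately show ?thesis using that by auto
  qed
  have "istopology ?P"
    unfolding istopology_def using inter union by blast
  then show ?thesis
    unfolding direct_limit_topology_def by (simp add: topology_inverse')
qed

definition cantor_cube :: "(nat \<Rightarrow> bool) topology" where
  "cantor_cube = product_topology (\<lambda>_. discrete_topology UNIV) UNIV"

text \<open>
  The power \<open>n\<close> of the Cantor cube, written as the product of \<open>n\<close> copies of the cube with
  infinitely many copies of the one-point space \<open>{p}\<close>. This makes the identification of each
  power with the subspace \<open>(\<dots>) \<times> {p}\<close> of the next one an actual inclusion.
\<close>

definition cantor_power :: "(nat \<Rightarrow> bool) \<Rightarrow> nat \<Rightarrow> (nat \<Rightarrow> nat \<Rightarrow> bool) topology" where
  "cantor_power p n =
     product_topology (\<lambda>i. if i < n then cantor_cube else subtopology cantor_cube {p}) UNIV"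

lemma topspace_cantor_power: "topspace (cantor_power p n) = {x. \<forall>i\<ge>n. x i = p}"
  by (auto simp: cantor_power_def cantor_cube_def PiE_iff split: if_splits)

lemma cantor_power_subspace:
  assumes "m \<le> n"
  shows "subtopology (cantor_power p n) (topspace (cantor_power p m)) = cantor_power p m"
proof -
  let ?S = "\<lambda>i. if i < m then UNIV else {p}"
  have "topspace (cantor_power p m) = (\<Pi>\<^sub>E i\<in>UNIV. ?S i)"
    by (auto simp: topspace_cantor_power PiE_iff split: if_splits)
  moreover have "subtopology (if i < n then cantor_cube else subtopology cantor_cube {p}) (?S i) =
      (if i < m then cantor_cube else subtopology cantor_cube {p})" for i
    using assms by (auto simp: subtopology_subtopology)
  ultimately show ?thesis
    unfolding cantor_power_def by (simp only: subtopology_product_topology)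
qed

definition cantor_power_limit :: "(nat \<Rightarrow> bool) \<Rightarrow> (nat \<Rightarrow> nat \<Rightarrow> bool) topology" where
  "cantor_power_limit p = direct_limit_topology (\<lambda>n. cantor_power p (Suc n))"

end

theory Submission
  imports Defs "HOL-Algebra.Coset"
begin

text \<open>
  Let \<open>G\<close> carry the weak topology of an increasing sequence of closed sets \<open>M n\<close>, finite unions of closed
  metrizable sets. If \<open>G\<close> is separable and not metrizable, it is not first countable, and this yields a
  fan: sequences \<open>t n\<close> converging to the identity such that every compact set misses all but
  finitely many of them. A fan forces closed metrizable subspaces to be locally compact, and
  separability then allows replacing them by countably many compact sets; punctiformity makes
  all compact subsets of \<open>G\<close> zero-dimensional and metrizable. If \<open>E\<close> is compact, \<open>P\<close> is a perfect compact set
  containing the identity (there is one as \<open>G\<close> is uncountable) and \<open>F = E P\<close>, then some \<open>t n\<close> avoids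
  \<open>F\<inverse> F\<close>, so that \<open>E\<close> is nowhere dense in the perfect compact set \<open>F ({1} \<union> range (t n))\<close>. Hence \<open>G\<close> is
  the direct limit of a tower of compact zero-dimensional sets, each perfect and containing the previous one as
  a nowhere dense subset. The finite powers of the Cantor cube form such a tower too, and
  homeomorphisms between corresponding levels of two such towers extend to the next level.
\<close>

section \<open>Compact zero-dimensional spaces\<close>

text \<open>A weak topology need not be first countable, so closures in \<open>G\<close> cannot be
  described by sequences. Sequences are therefore only taken inside a single metrizable piece
  \<open>K i\<close>, and \<open>M n\<close> serves as a finite union of pieces. The fan comes from
  this very defect: if no \<open>M n\<close> contains an open neighbourhood of the identity, then
  limits of points outside \<open>M n\<close> occur at, or arbitrarily near, the identity for every
  n, and left translation moves these limits to the identity. A compact set meets only finitely many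
  of the translated sequences because it lies in some \<open>M N\<close>, and so does its product
  with a convergent sequence together with its limit.

  Being perfect and containing the previous level as a nowhere dense set are merged into one
  condition that asks for two points in every nonempty open set off the previous level. Two points
  are what the extension of homeomorphisms consumes: both values of a new bit must be realizable
  where the closed set prescribes nothing. Since the towers start at a single point, no condition on
  the base point \<open>p\<close> arises.\<close>

abbreviation discrete :: "'a topology" where
  "discrete \<equiv> discrete_topology UNIV"

lemma continuous_map_into_discrete:
  "continuous_map X discrete f \<longleftrightarrow> (\<forall>y. openin X {x \<in> topspace X. f x = y})"
proof
  assume "continuous_map X discrete f"
  then have "openin X {x \<in> topspace X. f x \<in> {y}}" for y
    by (intro openin_continuous_map_preimage[where Y = discrete]) auto
  then show "\<forall>y. openin X {x \<in> topspace X. f x = y}" by simp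
next
  assume R: "\<forall>y. openin X {x \<in> topspace X. f x = y}"
  have "openin X {x \<in> topspace X. f x \<in> U}" for U
  proof -
    have "{x \<in> topspace X. f x \<in> U} = (\<Union>y\<in>U. {x \<in> topspace X. f x = y})" by auto
    then show ?thesis using R by auto
  qed
  then show "continuous_map X discrete f" by (simp add: continuous_map_def)
qed

lemma continuous_map_discrete_compose2:
  assumes "continuous_map X discrete f" "continuous_map X discrete g"
  shows "continuous_map X discrete (\<lambda>x. h (f x) (g x))"
  unfolding continuous_map_into_discrete
proof
  fix y
  have "openin X (\<Union>a. \<Union>b\<in>{b. h a b = y}. {x \<in> topspace X. f x = a} \<inter> {x \<in> topspace X. g x = b})"
    using assms unfolding continuous_map_into_discrete by blast
  moreover have "{x \<in> topspace X. h (f x) (g x) = y} =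
    (\<Union>a. \<Union>b\<in>{b. h a b = y}. {x \<in> topspace X. f x = a} \<inter> {x \<in> topspace X. g x = b})"
    by auto
  ultimately show "openin X {x \<in> topspace X. h (f x) (g x) = y}" by simp
qed

lemma openin_cantor_cubeD:
  assumes "openin cantor_cube U" "z \<in> U"
  obtains n where "\<And>y. (\<And>i. i < n \<Longrightarrow> y i = z i) \<Longrightarrow> y \<in> U"
proof -
  obtain V where V: "finite {i. V i \<noteq> (UNIV::bool set)}" "z \<in> Pi\<^sub>E UNIV V" "Pi\<^sub>E UNIV V \<subseteq> U"
    using assms unfolding cantor_cube_def openin_product_topology_alt by auto
  obtain n where n: "\<forall>i\<in>{i. V i \<noteq> (UNIV::bool set)}. i < n"
    using V(1) finite_nat_set_iff_bounded by blast
  show thesis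
  proof (rule that)
    fix y assume y: "\<And>i. i < n \<Longrightarrow> y i = z i"
    have "y i \<in> V i" for i
    proof (cases "i < n")
      case True then show ?thesis using V(2) y by auto
    next
      case False then show ?thesis using n by blast
    qed
    then show "y \<in> U" using V(3) by auto
  qed
qed

lemma topspace_cantor_cube [simp]: "topspace cantor_cube = UNIV"
  by (simp add: cantor_cube_def)

lemma Hausdorff_cantor_cube: "Hausdorff_space cantor_cube"
  by (simp add: cantor_cube_def Hausdorff_space_product_topology)

lemma compact_cantor_cube: "compact_space cantor_cube"
  by (simp add: cantor_cube_def compact_space_product_topology compact_space_discrete_topology)

lemma continuous_map_into_cantor_cube:
  "continuous_map X cantor_cube f \<longleftrightarrow> (\<forall>k. continuous_map X discrete (\<lambda>x. f x k))"
  by (simp add: cantor_cube_def continuous_map_componentwise_UNIV)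

text \<open>By compactness the injection is an embedding, so these are the compact metrizable
  zero-dimensional spaces, the empty one included. Countably many clopen sets that separate points
  are built into the definition; the back-and-forth argument enumerates them as coordinates.\<close>

definition compact_zero_dim :: "'a topology \<Rightarrow> bool" where
  "compact_zero_dim X \<longleftrightarrow>
     compact_space X \<and> (\<exists>\<phi>. continuous_map X cantor_cube \<phi> \<and> inj_on \<phi> (topspace X))"

lemma compact_zero_dim_imp_Hausdorff: "compact_zero_dim X \<Longrightarrow> Hausdorff_space X"
  unfolding compact_zero_dim_def using Hausdorff_cantor_cube Hausdorff_space_injective_preimage by blast

lemma compact_zero_dim_connectedin:
  assumes "compact_zero_dim X" "connectedin X C" "x \<in> C" "y \<in> C"
  shows "x = y"
proof -
  obtain \<phi> where \<phi>: "continuous_map X cantor_cube \<phi>" "inj_on \<phi> (topspace X)"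
    using assms(1) compact_zero_dim_def by blast
  have "\<phi> x k = \<phi> y k" for k
  proof -
    have "connectedin discrete ((\<lambda>x. \<phi> x k) ` C)"
      using assms(2) \<phi>(1) connectedin_continuous_map_image continuous_map_into_cantor_cube by metis
    then show ?thesis
      using assms(3,4) unfolding connectedin_discrete_topology by auto
  qed
  then have "\<phi> x = \<phi> y" by auto
  then show ?thesis
    using \<phi>(2) assms connectedin_subset_topspace by (metis inj_onD subsetD)
qed

text \<open>Connected sets have at most one point, so none meets two disjoint closed sets; in a
  compact Hausdorff space this already yields a separating clopen set.\<close>

lemma compact_zero_dim_separate:
  assumes X: "compact_zero_dim X" and "closedin X S" "closedin X T" "disjnt S T"
  obtains w :: "'a \<Rightarrow> bool" where "continuous_map X discrete w" "\<And>x. x \<in> S \<Longrightarrow> w x" "\<And>x. x \<in> T \<Longrightarrow> \<not> w x"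
proof -
  have "separated_between X S T"
  proof (rule cut_wire_fence_theorem)
    show "compact_space X" "Hausdorff_space X"
      using X compact_zero_dim_imp_Hausdorff compact_zero_dim_def by auto
    show "disjnt C S \<or> disjnt C T" if "connectedin X C" for C
      using compact_zero_dim_connectedin[OF X that] assms(4) unfolding disjnt_iff by metis
  qed (use assms in auto)
  then obtain U where U: "closedin X U" "openin X U" "S \<subseteq> U" "T \<subseteq> topspace X - U"
    using separated_between by metis
  have "continuous_map X discrete (\<lambda>x. x \<in> U)"
    unfolding continuous_map_into_discrete
  proof
    fix y show "openin X {x \<in> topspace X. (x \<in> U) = y}"
    proof (cases y)
      case True
      then have "{x \<in> topspace X. (x \<in> U) = y} = U" using U(2) openin_subset by auto
      then show ?thesis using U by simp
    next
      case False
      then have "{x \<in> topspace X. (x \<in> U) = y} = topspace X - U" by auto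
      then show ?thesis using U by auto
    qed
  qed
  with U that show thesis by blast
qed

text \<open>For a T1 space and closed \<open>A\<close> this says that \<open>X\<close> has no
  isolated point and \<open>A\<close> is nowhere dense: then \<open>V - A\<close> is open and
  nonempty, hence not a singleton.\<close>

definition thick_complement :: "'a topology \<Rightarrow> 'a set \<Rightarrow> bool" where
  "thick_complement X A \<longleftrightarrow>
     (\<forall>V. openin X V \<longrightarrow> V \<noteq> {} \<longrightarrow> (\<exists>u v. u \<in> V - A \<and> v \<in> V - A \<and> u \<noteq> v))"

lemma thick_complementE:
  assumes "thick_complement X A" "openin X V" "x \<in> V"
  obtains u v where "u \<in> V" "u \<notin> A" "v \<in> V" "v \<notin> A" "u \<noteq> v"
proof -
  have "V \<noteq> {}" using assms(3) by auto
  then obtain u v where "u \<in> V - A \<and> v \<in> V - A \<and> u \<noteq> v"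
    using assms(1,2) unfolding thick_complement_def by metis
  then show thesis using that by auto
qed

section \<open>Extending homeomorphisms between closed subsets\<close>

text \<open>
  The step of a back-and-forth argument: locally constant maps \<open>c\<close>, \<open>c'\<close> with the same image that
  correspond under \<open>f\<close> are refined by a further bit. To realize all combinations that occur in \<open>X\<close>, the
  clopen set of \<open>Y\<close> defining the new bit is chosen to contain one of two points outside \<open>B\<close>
  in every fibre of \<open>c'\<close>, but not the other.
\<close>

lemma colouring_extend:
  fixes c :: "'a \<Rightarrow> 'c" and c' :: "'b \<Rightarrow> 'c" and b :: "'a \<Rightarrow> bool"
  assumes X: "compact_zero_dim X" and Y: "compact_zero_dim Y"
    and A: "closedin X A" and B: "closedin Y B"
    and fg: "homeomorphic_maps (subtopology X A) (subtopology Y B) f g"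
    and thick: "thick_complement Y B"
    and c: "continuous_map X discrete c" and c': "continuous_map Y discrete c'"
    and b: "continuous_map X discrete b"
    and im: "c ` topspace X = c' ` topspace Y"
    and cf: "\<And>a. a \<in> A \<Longrightarrow> c' (f a) = c a"
  obtains b' where "continuous_map Y discrete b'"
    "(\<lambda>x. (c x, b x)) ` topspace X = (\<lambda>y. (c' y, b' y)) ` topspace Y"
    "\<And>a. a \<in> A \<Longrightarrow> b' (f a) = b a"
proof -
  have AX: "A \<subseteq> topspace X" and BY: "B \<subseteq> topspace Y" using A B closedin_subset by auto
  then have fAB: "f a \<in> B" and gf: "g (f a) = a" if "a \<in> A" for a
    using fg that unfolding homeomorphic_maps_def continuous_map_def by auto
  have f_inj: "a = a'" if "f a = f a'" "a \<in> A" "a' \<in> A" for a a'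
    using gf that by metis
  define \<Gamma> where "\<Gamma> = c ` topspace X"
  \<comment> \<open>A compact subset of a discrete space is finite. This makes \<open>u\<close>
    \<Gamma>\<open>and\<close>v \<open>\<Gamma>\<close> closed below.\<close>
  have "finite \<Gamma>"
    using image_compactin[OF _ c, of "topspace X"] X
    unfolding \<Gamma>_def compact_zero_dim_def compact_space_def by (auto simp: compactin_discrete_topology)
  have "\<exists>u v. u \<in> topspace Y - B \<and> v \<in> topspace Y - B \<and> u \<noteq> v \<and> c' u = \<gamma> \<and> c' v = \<gamma>"
    if \<gamma>: "\<gamma> \<in> \<Gamma>" for \<gamma>
  proof -
    have op: "openin Y {y \<in> topspace Y. c' y = \<gamma>}"
      using c' by (simp add: continuous_map_into_discrete)
    obtain y where "y \<in> {y \<in> topspace Y. c' y = \<gamma>}"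
      using \<gamma> unfolding \<Gamma>_def im by auto
    from thick_complementE[OF thick op this] obtain u v where
      "u \<in> {y \<in> topspace Y. c' y = \<gamma>}" "u \<notin> B" "v \<in> {y \<in> topspace Y. c' y = \<gamma>}" "v \<notin> B" "u \<noteq> v"
      by blast
    then show ?thesis by blast
  qed
  then obtain u v where uv: "\<And>\<gamma>. \<gamma> \<in> \<Gamma> \<Longrightarrow> u \<gamma> \<in> topspace Y - B \<and> v \<gamma> \<in> topspace Y - B \<and>
      u \<gamma> \<noteq> v \<gamma> \<and> c' (u \<gamma>) = \<gamma> \<and> c' (v \<gamma>) = \<gamma>"
    by metis
  have closed_image: "closedin Y (f ` {a \<in> A. b a = t})" for t
  proof -
    have "closedin X {x \<in> topspace X. b x \<in> {t}}"
      by (rule closedin_continuous_map_preimage[OF b]) auto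
    then have "closedin X (A \<inter> {x \<in> topspace X. b x \<in> {t}})" by (rule closedin_Int[OF A])
    moreover have "A \<inter> {x \<in> topspace X. b x \<in> {t}} = {a \<in> A. b a = t}" using AX by auto
    ultimately have "closedin (subtopology X A) {a \<in> A. b a = t}"
      using A by (metis (no_types, lifting) closedin_subset_topspace mem_Collect_eq subsetI)
    moreover have "homeomorphic_map (subtopology X A) (subtopology Y B) f"
      using fg homeomorphic_map_maps by blast
    ultimately have "closedin (subtopology Y B) (f ` {a \<in> A. b a = t})"
      by (meson closed_map_def homeomorphic_imp_closed_map)
    then show ?thesis using B closedin_trans_full by blast
  qed
  have fin: "closedin Y F" if "finite F" "F \<subseteq> topspace Y" for F
    using Y compact_zero_dim_imp_Hausdorff that by (metis Hausdorff_imp_t1_space t1_space_closedin_finite)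
  let ?S = "f ` {a \<in> A. b a = True} \<union> u ` \<Gamma>" and ?T = "f ` {a \<in> A. b a = False} \<union> v ` \<Gamma>"
  have cl: "closedin Y ?S" "closedin Y ?T"
    using \<open>finite \<Gamma>\<close> uv by (intro closedin_Un closed_image fin; auto)+
  have dj: "disjnt ?S ?T"
    using uv fAB f_inj unfolding disjnt_iff by (smt (verit, del_insts) DiffE UnE image_iff mem_Collect_eq)
  obtain w :: "'b \<Rightarrow> bool" where
    w: "continuous_map Y discrete w" "\<And>y. y \<in> ?S \<Longrightarrow> w y" "\<And>y. y \<in> ?T \<Longrightarrow> \<not> w y"
    by (rule compact_zero_dim_separate[OF Y cl dj]) blast
  \<comment> \<open>If \<open>b\<close> is constant on a fibre of \<open>c\<close>, the bit is
    forced to that constant, since \<open>w\<close> would produce a combination that does not occur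
    in \<open>X\<close>. On the other fibres \<open>w\<close> is kept; it takes both values there,
    at \<open>u \<gamma>\<close> and \<open>v \<gamma>\<close>.\<close>
  define h where "h = (\<lambda>\<gamma> t. let S = b ` {x \<in> topspace X. c x = \<gamma>} in
      if S = {True} then True else if S = {False} then False else t)"
  define b' where "b' = (\<lambda>y. h (c' y) (w y))"
  show thesis
  proof
    show "continuous_map Y discrete b'"
      unfolding b'_def by (rule continuous_map_discrete_compose2[OF c' w(1)])
    show "b' (f a) = b a" if "a \<in> A" for a
    proof -
      have "b a \<in> b ` {x \<in> topspace X. c x = c a}" using that AX by auto
      moreover have "w (f a) = b a" using w(2,3) that by blast
      ultimately show ?thesis
        unfolding b'_def h_def Let_def cf[OF that] by (cases "b a") auto
    qed
    show "(\<lambda>x. (c x, b x)) ` topspace X = (\<lambda>y. (c' y, b' y)) ` topspace Y"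
    proof (intro subset_antisym subsetI)
      fix z assume "z \<in> (\<lambda>x. (c x, b x)) ` topspace X"
      then obtain x where x: "x \<in> topspace X" "z = (c x, b x)" by auto
      let ?S = "b ` {x' \<in> topspace X. c x' = c x}"
      have \<gamma>: "c x \<in> \<Gamma>" using x \<Gamma>_def by auto
      have wu: "w (u (c x))" "\<not> w (v (c x))" using w \<gamma> by blast+
      have "b x \<in> ?S" using x by auto
      then have "b' (u (c x)) = b x \<or> b' (v (c x)) = b x"
        unfolding b'_def h_def Let_def using uv[OF \<gamma>] wu by (cases "b x") auto
      then obtain y where y: "y \<in> topspace Y" "c' y = c x" "b' y = b x"
        using uv[OF \<gamma>] by blast
      then have "z = (c' y, b' y)" using x by simp
      then show "z \<in> (\<lambda>y. (c' y, b' y)) ` topspace Y"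
        using y(1) by (rule image_eqI)
    next
      fix z assume "z \<in> (\<lambda>y. (c' y, b' y)) ` topspace Y"
      then obtain y where y: "y \<in> topspace Y" "z = (c' y, b' y)" by auto
      let ?S = "b ` {x' \<in> topspace X. c x' = c' y}"
      obtain x where "x \<in> topspace X" "c x = c' y"
        using y(1) im by (metis imageE imageI)
      then have "b x \<in> ?S" by auto
      have "b' y \<in> ?S"
      proof (rule ccontr)
        assume n: "b' y \<notin> ?S"
        have "t = b x" if "t \<in> ?S" for t
          using n that \<open>b x \<in> ?S\<close> by (cases t; cases "b x"; cases "b' y"; simp)
        then have "?S = {b x}" using \<open>b x \<in> ?S\<close> by blast
        then have "b' y = b x" unfolding b'_def h_def Let_def by (cases "b x") auto
        then show False using n \<open>b x \<in> ?S\<close> by simp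
      qed
      then obtain x0 where x0: "b' y = b x0" "x0 \<in> {x \<in> topspace X. c x = c' y}"
        by (rule imageE)
      then have "z = (c x0, b x0)" "x0 \<in> topspace X" using y by simp_all
      then show "z \<in> (\<lambda>x. (c x, b x)) ` topspace X"
        by (rule image_eqI)
    qed
  qed
qed

text \<open>
  Alternately extending the coordinates of embeddings of \<open>X\<close> and of \<open>Y\<close> into the Cantor cube gives
  embeddings \<open>\<Phi>\<close>, \<open>\<Psi>\<close> with \<open>\<Psi> \<circ> f = \<Phi>\<close> on \<open>A\<close> whose images agree in every finite set of
  coordinates, hence are equal by compactness.
\<close>

theorem homeomorphic_maps_extend:
  assumes X: "compact_zero_dim X" and Y: "compact_zero_dim Y"
    and A: "closedin X A" and B: "closedin Y B"
    and fg: "homeomorphic_maps (subtopology X A) (subtopology Y B) f g"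
    and thickA: "thick_complement X A" and thickB: "thick_complement Y B"
    and ne: "topspace X = {} \<longleftrightarrow> topspace Y = {}"
  obtains F G where "homeomorphic_maps X Y F G" "\<And>a. a \<in> A \<Longrightarrow> F a = f a" "\<And>b. b \<in> B \<Longrightarrow> G b = g b"
proof -
  have AX: "A \<subseteq> topspace X" and BY: "B \<subseteq> topspace Y" using A B closedin_subset by auto
  then have fAB: "f a \<in> B" and gf: "g (f a) = a" if "a \<in> A" for a
    using fg that unfolding homeomorphic_maps_def continuous_map_def by auto
  have gBA: "g b \<in> A" and fg': "f (g b) = b" if "b \<in> B" for b
    using fg that AX BY unfolding homeomorphic_maps_def continuous_map_def by auto
  have gf_maps: "homeomorphic_maps (subtopology Y B) (subtopology X A) g f"
    using fg homeomorphic_maps_sym by blast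
  obtain \<phi> where \<phi>: "continuous_map X cantor_cube \<phi>" "inj_on \<phi> (topspace X)"
    using X compact_zero_dim_def by blast
  obtain \<psi> where \<psi>: "continuous_map Y cantor_cube \<psi>" "inj_on \<psi> (topspace Y)"
    using Y compact_zero_dim_def by blast
  have \<phi>k: "continuous_map X discrete (\<lambda>x. \<phi> x k)" and \<psi>k: "continuous_map Y discrete (\<lambda>y. \<psi> y k)" for k
    using \<phi> \<psi> continuous_map_into_cantor_cube by blast+
  define good where "good = (\<lambda>(c :: _ \<Rightarrow> bool list, c' :: _ \<Rightarrow> bool list).
      continuous_map X discrete c \<and> continuous_map Y discrete c' \<and> c ` topspace X = c' ` topspace Y \<and>
      (\<forall>a\<in>A. c' (f a) = c a))"
  \<comment> \<open>Stage \<open>n\<close> treats coordinate \<open>n div 2\<close>, of \<phi> for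
    even \<open>n\<close> and of \<psi> for odd \<open>n\<close>; the bit on the other side is
    supplied by \<open>colouring_extend\<close>. Colours are bit lists with the newest bit in front,
    so all stages have the same type.\<close>
  define appends where "appends = (\<lambda>n s s' b b'. s' = (\<lambda>x. b x # fst s x, \<lambda>y. b' y # snd s y) \<and>
      continuous_map X discrete b \<and> continuous_map Y discrete b' \<and> (\<forall>a\<in>A. b' (f a) = b a) \<and>
      (even n \<longrightarrow> b = (\<lambda>x. \<phi> x (n div 2))) \<and> (odd n \<longrightarrow> b' = (\<lambda>y. \<psi> y (n div 2))))"
  have step: "\<exists>s'. good s' \<and> (\<exists>b b'. appends n s s' b b')" if "good s" for s n
  proof -
    obtain c c' where s: "s = (c, c')" by force
    have c: "continuous_map X discrete c" "continuous_map Y discrete c'" "c ` topspace X = c' ` topspace Y"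
      "\<And>a. a \<in> A \<Longrightarrow> c' (f a) = c a"
      using that unfolding good_def s by auto
    obtain b b' where b: "continuous_map X discrete b" "continuous_map Y discrete b'"
      "(\<lambda>x. (c x, b x)) ` topspace X = (\<lambda>y. (c' y, b' y)) ` topspace Y"
      "\<And>a. a \<in> A \<Longrightarrow> b' (f a) = b a"
      "even n \<longrightarrow> b = (\<lambda>x. \<phi> x (n div 2))" "odd n \<longrightarrow> b' = (\<lambda>y. \<psi> y (n div 2))"
    proof (cases "even n")
      case True
      from colouring_extend[OF X Y A B fg thickB c(1,2) \<phi>k c(3,4), of "n div 2"]
      obtain b' where "continuous_map Y discrete b'"
        "(\<lambda>x. (c x, \<phi> x (n div 2))) ` topspace X = (\<lambda>y. (c' y, b' y)) ` topspace Y"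
        "\<And>a. a \<in> A \<Longrightarrow> b' (f a) = \<phi> a (n div 2)"
        by blast
      with True show thesis using that[OF \<phi>k] by blast
    next
      case False
      have "c (g b) = c' b" if "b \<in> B" for b using c(4)[OF gBA[OF that]] fg'[OF that] by simp
      from colouring_extend[OF Y X B A gf_maps thickA c(2,1) \<psi>k c(3)[symmetric] this, of "n div 2"]
      obtain b where b: "continuous_map X discrete b"
        "(\<lambda>y. (c' y, \<psi> y (n div 2))) ` topspace Y = (\<lambda>x. (c x, b x)) ` topspace X"
        "\<And>a. a \<in> B \<Longrightarrow> b (g a) = \<psi> a (n div 2)"
        by blast
      have "\<psi> (f a) (n div 2) = b a" if "a \<in> A" for a using b(3)[OF fAB[OF that]] gf[OF that] by simp
      then show thesis using that[OF b(1) \<psi>k b(2)[symmetric]] False by blast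
    qed
    let ?s' = "(\<lambda>x. b x # c x, \<lambda>y. b' y # c' y)"
    have "(\<lambda>(l, t). t # l) ` (\<lambda>x. (c x, b x)) ` topspace X = (\<lambda>(l, t). t # l) ` (\<lambda>y. (c' y, b' y)) ` topspace Y"
      using b(3) by simp
    then have im: "(\<lambda>x. b x # c x) ` topspace X = (\<lambda>y. b' y # c' y) ` topspace Y"
      by (simp add: image_image)
    have "continuous_map X discrete (\<lambda>x. b x # c x)" "continuous_map Y discrete (\<lambda>y. b' y # c' y)"
      by (rule continuous_map_discrete_compose2[OF b(1) c(1)], rule continuous_map_discrete_compose2[OF b(2) c(2)])
    then have "good ?s'" unfolding good_def using im b(4) c(4) by auto
    moreover have "appends n s ?s' b b'"
      unfolding appends_def s by (intro conjI ballI) (use b in simp_all)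
    ultimately show ?thesis by blast
  qed
  \<comment> \<open>Constant colourings have equal images only because \<open>X\<close> and
    \<open>Y\<close> are both empty or both nonempty.\<close>
  have "good (\<lambda>_. [], \<lambda>_. [])"
    unfolding good_def using ne by (simp add: image_constant_conv)
  then have "\<exists>s. \<forall>n. good (s n) \<and> (\<exists>b b'. appends n (s n) (s (Suc n)) b b')"
    by (intro dependent_nat_choice) (use step in blast)+
  then obtain s b b' where s: "\<And>n. good (s n)" and "\<And>n. appends n (s n) (s (Suc n)) (b n) (b' n)"
    by metis
  then have bs: "\<And>n. s (Suc n) = (\<lambda>x. b n x # fst (s n) x, \<lambda>y. b' n y # snd (s n) y)"
    and bc: "\<And>n. continuous_map X discrete (b n)" "\<And>n. continuous_map Y discrete (b' n)"
    and bf: "\<And>n a. a \<in> A \<Longrightarrow> b' n (f a) = b n a"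
    and be: "\<And>n. even n \<Longrightarrow> b n = (\<lambda>x. \<phi> x (n div 2))"
    and bo: "\<And>n. odd n \<Longrightarrow> b' n = (\<lambda>y. \<psi> y (n div 2))"
    unfolding appends_def by blast+
  define \<Phi> where "\<Phi> = (\<lambda>x n. b n x)"
  define \<Psi> where "\<Psi> = (\<lambda>y n. b' n y)"
  have \<Phi>c: "continuous_map X cantor_cube \<Phi>" and \<Psi>c: "continuous_map Y cantor_cube \<Psi>"
    unfolding \<Phi>_def \<Psi>_def continuous_map_into_cantor_cube using bc by blast+
  \<comment> \<open>Coordinate \<open>2 * k\<close> of \<Phi> is coordinate \<open>k\<close> of
    \<phi>, and coordinate \<open>2 * k + 1\<close> of \<Psi> is coordinate \<open>k\<close> of
    \<psi>, so both maps inherit injectivity.\<close>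
  have \<Phi>i: "inj_on \<Phi> (topspace X)"
  proof (rule inj_onI)
    fix x y assume xy: "x \<in> topspace X" "y \<in> topspace X" "\<Phi> x = \<Phi> y"
    have "\<phi> x k = \<phi> y k" for k
      using fun_cong[OF xy(3), of "2 * k"] be[of "2 * k"] unfolding \<Phi>_def by simp
    then have "\<phi> x = \<phi> y" by (rule ext)
    then show "x = y" using \<phi>(2) xy by (auto dest: inj_onD)
  qed
  have \<Psi>i: "inj_on \<Psi> (topspace Y)"
  proof (rule inj_onI)
    fix x y assume xy: "x \<in> topspace Y" "y \<in> topspace Y" "\<Psi> x = \<Psi> y"
    have "\<psi> x k = \<psi> y k" for k
      using fun_cong[OF xy(3), of "2 * k + 1"] bo[of "2 * k + 1"] unfolding \<Psi>_def by simp
    then have "\<psi> x = \<psi> y" by (rule ext)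
    then show "x = y" using \<psi>(2) xy by (auto dest: inj_onD)
  qed
  have pref: "fst (s n) x = snd (s n) y \<Longrightarrow> i < n \<Longrightarrow> \<Phi> x i = \<Psi> y i" for n i x y
  proof (induction n)
    case (Suc n)
    then show ?case unfolding bs \<Phi>_def \<Psi>_def by (auto simp: less_Suc_eq)
  qed simp
  have im_eq: "fst (s n) ` topspace X = snd (s n) ` topspace Y" for n
    using s[of n] unfolding good_def by (auto split: prod.splits)
  have closed: "closedin cantor_cube (\<Phi> ` topspace X)" "closedin cantor_cube (\<Psi> ` topspace Y)"
    using X Y \<Phi>c \<Psi>c Hausdorff_cantor_cube
    unfolding compact_zero_dim_def compact_space_def by (auto intro!: compactin_imp_closedin image_compactin)
  have dense: "z \<in> C" if C: "closedin cantor_cube C" and n: "\<And>n. \<exists>y\<in>C. \<forall>i<n. y i = z i" for z C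
  proof (rule ccontr)
    assume "z \<notin> C"
    then have "openin cantor_cube (UNIV - C)" "z \<in> UNIV - C" using C by (auto simp: closedin_def)
    then obtain m where "\<And>y. (\<And>i. i < m \<Longrightarrow> y i = z i) \<Longrightarrow> y \<in> UNIV - C"
      using openin_cantor_cubeD by metis
    then show False using n[of m] by blast
  qed
  have images: "\<Phi> ` topspace X = \<Psi> ` topspace Y"
  proof (intro subset_antisym subsetI)
    fix z assume "z \<in> \<Phi> ` topspace X"
    then obtain x where x: "x \<in> topspace X" "z = \<Phi> x" by auto
    show "z \<in> \<Psi> ` topspace Y"
    proof (rule dense[OF closed(2)])
      fix n
      obtain y where "y \<in> topspace Y" "fst (s n) x = snd (s n) y"
        using x im_eq[of n] by (metis imageE imageI)
      then show "\<exists>y\<in>\<Psi> ` topspace Y. \<forall>i<n. y i = z i" using pref[of n x y] x by auto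
    qed
  next
    fix z assume "z \<in> \<Psi> ` topspace Y"
    then obtain y where y: "y \<in> topspace Y" "z = \<Psi> y" by auto
    show "z \<in> \<Phi> ` topspace X"
    proof (rule dense[OF closed(1)])
      fix n
      obtain x where "x \<in> topspace X" "fst (s n) x = snd (s n) y"
        using y im_eq[of n] by (metis imageE imageI)
      then show "\<exists>y\<in>\<Phi> ` topspace X. \<forall>i<n. y i = z i" using pref[of n x y] y by auto
    qed
  qed
  let ?Z = "subtopology cantor_cube (\<Phi> ` topspace X)"
  have HZ: "Hausdorff_space ?Z" by (simp add: Hausdorff_cantor_cube Hausdorff_space_subtopology)
  have "homeomorphic_map X ?Z \<Phi>"
    by (rule continuous_imp_homeomorphic_map)
      (use X \<Phi>c \<Phi>i HZ in \<open>auto simp: compact_zero_dim_def continuous_map_in_subtopology\<close>)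
  then obtain \<Phi>' where \<Phi>': "homeomorphic_maps X ?Z \<Phi> \<Phi>'"
    using homeomorphic_map_maps by blast
  have "homeomorphic_map Y ?Z \<Psi>"
    by (rule continuous_imp_homeomorphic_map)
      (use Y \<Psi>c \<Psi>i HZ in \<open>auto simp: compact_zero_dim_def continuous_map_in_subtopology images\<close>)
  then obtain \<Psi>' where \<Psi>': "homeomorphic_maps Y ?Z \<Psi> \<Psi>'"
    using homeomorphic_map_maps by blast
  show thesis
  proof
    show "homeomorphic_maps X Y (\<Psi>' \<circ> \<Phi>) (\<Phi>' \<circ> \<Psi>)"
      using \<Phi>' \<Psi>' homeomorphic_maps_sym by (blast intro: homeomorphic_maps_compose)
    have eq: "\<Psi> (f a) = \<Phi> a" if "a \<in> A" for a
      unfolding \<Phi>_def \<Psi>_def using bf[OF that] by blast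
    show "(\<Psi>' \<circ> \<Phi>) a = f a" if "a \<in> A" for a
      using \<Psi>' eq[OF that] fAB[OF that] BY unfolding homeomorphic_maps_def by (metis comp_apply subsetD)
    show "(\<Phi>' \<circ> \<Psi>) d = g d" if "d \<in> B" for d
      using \<Phi>' eq[OF gBA[OF that]] gBA[OF that] fg'[OF that] AX unfolding homeomorphic_maps_def
      by (metis comp_apply subsetD)
  qed
qed

section \<open>Direct limits of towers of compact zero-dimensional spaces\<close>

lemma topspace_direct_limit: "topspace (direct_limit_topology X) = (\<Union>n. topspace (X n))"
proof
  show "topspace (direct_limit_topology X) \<subseteq> (\<Union>n. topspace (X n))"
    using openin_topspace openin_direct_limit_topology by metis
  have "(\<Union>n. topspace (X n)) \<inter> topspace (X m) = topspace (X m)" for m by auto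
  then have "openin (direct_limit_topology X) (\<Union>n. topspace (X n))"
    unfolding openin_direct_limit_topology by simp
  then show "(\<Union>n. topspace (X n)) \<subseteq> topspace (direct_limit_topology X)"
    by (rule openin_subset)
qed

lemma continuous_map_direct_limit:
  assumes f: "\<And>n. continuous_map (X n) (Y n) (f n)"
    and F: "\<And>n x. x \<in> topspace (X n) \<Longrightarrow> F x = f n x"
  shows "continuous_map (direct_limit_topology X) (direct_limit_topology Y) F"
proof -
  have FY: "F x \<in> topspace (Y n)" if "x \<in> topspace (X n)" for n x
    using f[of n] F[OF that] that unfolding continuous_map_def by auto
  show ?thesis
    unfolding continuous_map_def topspace_direct_limit openin_direct_limit_topology
  proof (intro conjI allI impI funcsetI)
    show "F x \<in> (\<Union>n. topspace (Y n))" if "x \<in> (\<Union>n. topspace (X n))" for x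
      using FY that by blast
    fix U n assume U: "U \<subseteq> (\<Union>n. topspace (Y n)) \<and> (\<forall>n. openin (Y n) (U \<inter> topspace (Y n)))"
    have "openin (X n) {x \<in> topspace (X n). f n x \<in> U \<inter> topspace (Y n)}"
      using U f[of n] by (intro openin_continuous_map_preimage) auto
    moreover have "{x \<in> \<Union>n. topspace (X n). F x \<in> U} \<inter> topspace (X n) =
        {x \<in> topspace (X n). f n x \<in> U \<inter> topspace (Y n)}"
      using F FY by force
    ultimately show "openin (X n) ({x \<in> \<Union>n. topspace (X n). F x \<in> U} \<inter> topspace (X n))" by simp
  qed blast
qed

text \<open>The one-point level 0 makes all levels nonempty and gives the recursion of
  homeomorphisms its start. Level 0 itself is not perfect; the thickness condition speaks of the
  levels from 1 on.\<close>

definition thick_tower :: "(nat \<Rightarrow> 'a topology) \<Rightarrow> bool" where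
  "thick_tower X \<longleftrightarrow>
     (\<forall>n. compact_zero_dim (X n) \<and> topspace (X n) \<subseteq> topspace (X (Suc n)) \<and>
       subtopology (X (Suc n)) (topspace (X n)) = X n \<and>
       thick_complement (X (Suc n)) (topspace (X n))) \<and>
     (\<exists>x. topspace (X 0) = {x})"

text \<open>Each \<open>h (Suc n)\<close> extends \<open>h n\<close>, so every level containing
  \<open>x\<close> gives the same value, and choosing the least level glues the sequence into one
  function.\<close>

lemma thick_tower_coherent:
  assumes "\<And>n. topspace (X n) \<subseteq> topspace (X (Suc n))"
    and "\<And>n x. x \<in> topspace (X n) \<Longrightarrow> h (Suc n) x = h n x"
    and "x \<in> topspace (X n)"
  shows "h (LEAST n. x \<in> topspace (X n)) x = h n x"
proof -
  have *: "x \<in> topspace (X (m + k)) \<and> h (m + k) x = h m x" if "x \<in> topspace (X m)" for m k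
    by (induction k) (use that assms in auto)
  have "x \<in> topspace (X (LEAST n. x \<in> topspace (X n)))" "(LEAST n. x \<in> topspace (X n)) \<le> n"
    using assms(3) by (auto intro: LeastI Least_le)
  then show ?thesis using * by (metis le_add_diff_inverse)
qed

theorem thick_tower_direct_limits_homeomorphic:
  fixes X :: "nat \<Rightarrow> 'a topology" and Y :: "nat \<Rightarrow> 'b topology"
  assumes X: "thick_tower X" and Y: "thick_tower Y"
  shows "direct_limit_topology X homeomorphic_space direct_limit_topology Y"
proof -
  have czd: "compact_zero_dim (X n)" "compact_zero_dim (Y n)"
    and mono: "topspace (X n) \<subseteq> topspace (X (Suc n))" "topspace (Y n) \<subseteq> topspace (Y (Suc n))"
    and sub: "subtopology (X (Suc n)) (topspace (X n)) = X n" "subtopology (Y (Suc n)) (topspace (Y n)) = Y n"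
    and thick: "thick_complement (X (Suc n)) (topspace (X n))" "thick_complement (Y (Suc n)) (topspace (Y n))" for n
    using X Y unfolding thick_tower_def by auto
  obtain x0 y0 where x0: "topspace (X 0) = {x0}" "topspace (Y 0) = {y0}"
    using X Y unfolding thick_tower_def by auto
  have inX: "x0 \<in> topspace (X n)" for n
    using x0 mono(1) by (induction n) auto
  have inY: "y0 \<in> topspace (Y n)" for n
    using x0 mono(2) by (induction n) auto
  have closed: "closedin (X (Suc n)) (topspace (X n))" "closedin (Y (Suc n)) (topspace (Y n))" for n
  proof -
    have "compactin (X (Suc n)) (topspace (X n))" "compactin (Y (Suc n)) (topspace (Y n))"
      using czd[of n] sub[of n] mono[of n] unfolding compact_zero_dim_def compactin_subspace by auto
    then show "closedin (X (Suc n)) (topspace (X n))" "closedin (Y (Suc n)) (topspace (Y n))"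
      using czd[of "Suc n"] compact_zero_dim_imp_Hausdorff compactin_imp_closedin by auto
  qed
  define ok where "ok = (\<lambda>n (h, g). homeomorphic_maps (X n) (Y n) h g)"
  \<comment> \<open>The inverse maps are extended coherently as well, so that both directions glue
    and stay mutually inverse in the limit.\<close>
  define ext where "ext = (\<lambda>n (h :: 'a \<Rightarrow> 'b, g :: 'b \<Rightarrow> 'a) (h' :: 'a \<Rightarrow> 'b, g' :: 'b \<Rightarrow> 'a). (\<forall>x\<in>topspace (X n). h' x = h x) \<and> (\<forall>y\<in>topspace (Y n). g' y = g y))"
  have base: "ok 0 (\<lambda>_. y0, \<lambda>_. x0)"
    unfolding ok_def homeomorphic_maps_def using x0 by auto
  have step: "\<exists>s'. ok (Suc n) s' \<and> ext n s s'" if "ok n s" for n s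
  proof -
    obtain h g where s: "s = (h, g)" by force
    have hg: "homeomorphic_maps (subtopology (X (Suc n)) (topspace (X n)))
        (subtopology (Y (Suc n)) (topspace (Y n))) h g"
      using that unfolding ok_def s sub by simp
    obtain F G where "homeomorphic_maps (X (Suc n)) (Y (Suc n)) F G"
      "\<And>a. a \<in> topspace (X n) \<Longrightarrow> F a = h a" "\<And>b. b \<in> topspace (Y n) \<Longrightarrow> G b = g b"
      using homeomorphic_maps_extend[OF czd(1) czd(2) closed(1) closed(2) hg thick] inX inY by (metis empty_iff)
    then have "ok (Suc n) (F, G) \<and> ext n s (F, G)" unfolding ok_def ext_def s by auto
    then show ?thesis by blast
  qed
  have "\<exists>s. \<forall>n. ok n (s n) \<and> ext n (s n) (s (Suc n))"
    by (rule dependent_nat_choice) (use base step in blast)+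
  then obtain s where s: "\<And>n. ok n (s n)" "\<And>n. ext n (s n) (s (Suc n))" by blast
  define h where "h = (\<lambda>n. fst (s n))"
  define g where "g = (\<lambda>n. snd (s n))"
  have hg: "homeomorphic_maps (X n) (Y n) (h n) (g n)" for n
    using s(1)[of n] unfolding ok_def h_def g_def by (simp add: case_prod_beta)
  have h_ext: "h (Suc n) x = h n x" if "x \<in> topspace (X n)" for n x
    using s(2)[of n] that unfolding ext_def h_def by (simp add: case_prod_beta)
  have g_ext: "g (Suc n) x = g n x" if "x \<in> topspace (Y n)" for n x
    using s(2)[of n] that unfolding ext_def g_def by (simp add: case_prod_beta)
  define H where "H = (\<lambda>x. h (LEAST n. x \<in> topspace (X n)) x)"
  define K where "K = (\<lambda>y. g (LEAST n. y \<in> topspace (Y n)) y)"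
  have H: "H x = h n x" if "x \<in> topspace (X n)" for x n
    unfolding H_def by (rule thick_tower_coherent[of X h, OF mono(1) h_ext that])
  have K: "K x = g n x" if "x \<in> topspace (Y n)" for x n
    unfolding K_def by (rule thick_tower_coherent[of Y g, OF mono(2) g_ext that])
  have "homeomorphic_maps (direct_limit_topology X) (direct_limit_topology Y) H K"
    unfolding homeomorphic_maps_def
  proof (intro conjI ballI)
    show "continuous_map (direct_limit_topology X) (direct_limit_topology Y) H"
      using hg by (intro continuous_map_direct_limit[of X Y h] H) (auto simp: homeomorphic_maps_def)
    show "continuous_map (direct_limit_topology Y) (direct_limit_topology X) K"
      using hg by (intro continuous_map_direct_limit[of Y X g] K) (auto simp: homeomorphic_maps_def)
    show "K (H x) = x" if x: "x \<in> topspace (direct_limit_topology X)" for x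
    proof -
      obtain n where n: "x \<in> topspace (X n)"
        using x unfolding topspace_direct_limit by blast
      then have "h n x \<in> topspace (Y n)" "g n (h n x) = x"
        using hg[of n] unfolding homeomorphic_maps_def continuous_map_def by auto
      then show ?thesis using H[OF n] K by simp
    qed
    show "H (K x) = x" if x: "x \<in> topspace (direct_limit_topology Y)" for x
    proof -
      obtain n where n: "x \<in> topspace (Y n)"
        using x unfolding topspace_direct_limit by blast
      then have "g n x \<in> topspace (X n)" "h n (g n x) = x"
        using hg[of n] unfolding homeomorphic_maps_def continuous_map_def by auto
      then show ?thesis using K[OF n] H by simp
    qed
  qed
  then show ?thesis unfolding homeomorphic_space_def by blast
qed

lemma thick_tower_cantor_power: "thick_tower (cantor_power p)"
proof -
  have cont: "continuous_map (cantor_power p n) discrete (\<lambda>x. x i j)" for n i j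
  proof -
    have "continuous_map (cantor_power p n) (if i < n then cantor_cube else subtopology cantor_cube {p}) (\<lambda>x. x i)"
      unfolding cantor_power_def by (rule continuous_map_product_projection) simp
    then have "continuous_map (cantor_power p n) cantor_cube (\<lambda>x. x i)"
      by (auto split: if_splits simp: continuous_map_in_subtopology)
    then show ?thesis by (simp add: continuous_map_into_cantor_cube)
  qed
  have czd: "compact_zero_dim (cantor_power p n)" for n
    unfolding compact_zero_dim_def
  proof (intro conjI exI)
    show "compact_space (cantor_power p n)"
      unfolding cantor_power_def compact_space_product_topology
      by (auto simp: compact_cantor_cube compact_space_subtopology)
    let ?\<phi> = "\<lambda>x k. x (fst (prod_decode k)) (snd (prod_decode k))"
    show "continuous_map (cantor_power p n) cantor_cube ?\<phi>"
      unfolding continuous_map_into_cantor_cube using cont by blast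
    show "inj_on ?\<phi> (topspace (cantor_power p n))"
    proof (rule inj_onI)
      fix x y assume "?\<phi> x = ?\<phi> y"
      then have "x i j = y i j" for i j
        by (metis fst_conv prod_encode_inverse snd_conv)
      then show "x = y" by blast
    qed
  qed
  have thick: "thick_complement (cantor_power p (Suc n)) (topspace (cantor_power p n))" for n
    unfolding thick_complement_def
  proof (intro allI impI)
    fix V assume V: "openin (cantor_power p (Suc n)) V" "V \<noteq> {}"
    then obtain x where x: "x \<in> V" by blast
    then have xt: "x \<in> topspace (cantor_power p (Suc n))" using V openin_subset by blast
    \<comment> \<open>Coordinate \<open>n\<close> is free in the power \<open>Suc n\<close> and
      equal to \<open>p\<close> in the power \<open>n\<close>. Varying it alone moves
      \<open>x\<close> within \<open>V\<close> through points of which at most one lies in the power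
      \<open>n\<close>.\<close>
    define e where "e = (\<lambda>q. x(n := q))"
    have "continuous_map cantor_cube (cantor_power p (Suc n)) e"
      unfolding cantor_power_def continuous_map_componentwise_UNIV e_def
      using xt unfolding topspace_cantor_power by (auto simp: continuous_map_in_subtopology)
    then have "openin cantor_cube {q \<in> topspace cantor_cube. e q \<in> V}"
      using V openin_continuous_map_preimage by blast
    moreover have "x n \<in> {q \<in> topspace cantor_cube. e q \<in> V}" using x by (simp add: e_def)
    ultimately obtain m where m: "\<And>y. (\<And>i. i < m \<Longrightarrow> y i = x n i) \<Longrightarrow> y \<in> {q \<in> topspace cantor_cube. e q \<in> V}"
      using openin_cantor_cubeD by metis
    \<comment> \<open>Flipping one digit beyond the first \<open>m\<close> stays in the
      neighbourhood. Among \<open>y 0\<close>, \<open>y 1\<close>, \<open>y 2\<close>, which are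
      distinct, at least two differ from \<open>p\<close>.\<close>
    define y where "y = (\<lambda>k. (x n)(m + k := \<not> x n (m + k)))"
    have ye: "e (y k) \<in> V" for k using m[of "y k"] unfolding y_def by auto
    have yne: "y k \<noteq> y l" if "k \<noteq> l" for k l
    proof
      assume "y k = y l"
      then have "y k (m + k) = y l (m + k)" by simp
      then show False using that unfolding y_def by simp
    qed
    have en: "e q \<notin> topspace (cantor_power p n)" if "q \<noteq> p" for q
      using that unfolding topspace_cantor_power e_def by auto
    have einj: "e q \<noteq> e q'" if "q \<noteq> q'" for q q'
      using that unfolding e_def by (metis fun_upd_same)
    obtain k l where "k \<noteq> l" "y k \<noteq> p" "y l \<noteq> p"
      using yne[of 0 1] yne[of 0 2] yne[of 1 2] by (metis one_neq_zero zero_neq_numeral one_eq_numeral_iff num.distinct(1))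
    then show "\<exists>u v. u \<in> V - topspace (cantor_power p n) \<and> v \<in> V - topspace (cantor_power p n) \<and> u \<noteq> v"
      using en einj ye yne by (metis DiffI)
  qed
  have "topspace (cantor_power p 0) = {\<lambda>_. p}" unfolding topspace_cantor_power by auto
  moreover have "topspace (cantor_power p n) \<subseteq> topspace (cantor_power p (Suc n))" for n
    unfolding topspace_cantor_power by auto
  ultimately show ?thesis
    unfolding thick_tower_def using czd thick by (simp add: cantor_power_subspace)
qed

text \<open>The limit begins with the first power, whereas a \<open>thick_tower\<close> begins with
  a point. Prepending the power 0 changes nothing, because it is a subspace of the next
  power.\<close>

lemma cantor_power_limit_eq: "cantor_power_limit p = direct_limit_topology (cantor_power p)"
  unfolding topology_eq cantor_power_limit_def openin_direct_limit_topology
proof (intro allI iffI conjI)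
  have mono: "topspace (cantor_power p n) \<subseteq> topspace (cantor_power p (Suc n))" for n
    unfolding topspace_cantor_power by auto
  fix U
  { assume U: "U \<subseteq> (\<Union>n. topspace (cantor_power p (Suc n))) \<and>
        (\<forall>n. openin (cantor_power p (Suc n)) (U \<inter> topspace (cantor_power p (Suc n))))"
    then show "U \<subseteq> (\<Union>n. topspace (cantor_power p n))" by blast
    show "openin (cantor_power p n) (U \<inter> topspace (cantor_power p n))" for n
    proof -
      have "openin (subtopology (cantor_power p (Suc n)) (topspace (cantor_power p n)))
          ((U \<inter> topspace (cantor_power p (Suc n))) \<inter> topspace (cantor_power p n))"
        using U by (metis openin_subtopology)
      then show ?thesis using mono[of n] by (simp add: cantor_power_subspace Int_assoc inf_absorb2)
    qed }
  { assume U: "U \<subseteq> (\<Union>n. topspace (cantor_power p n)) \<and>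
        (\<forall>n. openin (cantor_power p n) (U \<inter> topspace (cantor_power p n)))"
    then show "U \<subseteq> (\<Union>n. topspace (cantor_power p (Suc n)))" using mono by blast
    show "openin (cantor_power p (Suc n)) (U \<inter> topspace (cantor_power p (Suc n)))" for n
      using U by blast }
qed

section \<open>Metrization\<close>

text \<open>The Urysohn functions separating nested pairs of basic open sets embed \<open>X\<close> into a countable power of the line.\<close>

lemma regular_second_countable_imp_metrizable_space:
  fixes X :: "'a topology"
  assumes reg: "regular_space X" and t1: "t1_space X" and sc: "second_countable X"
  shows "metrizable_space X"
proof -
  obtain \<B> where \<B>: "countable \<B>" "\<And>V. V \<in> \<B> \<Longrightarrow> openin X V"
    and base: "\<And>W x. openin X W \<Longrightarrow> x \<in> W \<Longrightarrow> \<exists>V\<in>\<B>. x \<in> V \<and> V \<subseteq> W"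
    using sc unfolding second_countable_def by metis
  have normal: "normal_space X"
    by (simp add: reg regular_Lindelof_imp_normal_space sc second_countable_imp_Lindelof_space)
  define P where "P = {(U, V) \<in> \<B> \<times> \<B>. X closure_of U \<subseteq> V}"
  have "countable P"
    by (rule countable_subset[of _ "\<B> \<times> \<B>"]) (use \<B> in \<open>auto simp: P_def\<close>)
  have "\<exists>f. continuous_map X euclideanreal f \<and> f ` (X closure_of fst p) \<subseteq> {0} \<and> f ` (topspace X - snd p) \<subseteq> {1}"
    if "p \<in> P" for p
  proof -
    have "closedin X (topspace X - snd p)" "disjnt (X closure_of fst p) (topspace X - snd p)"
      using that \<B> unfolding P_def disjnt_def by auto
    then show ?thesis
      using Urysohn_lemma_alt[OF normal closedin_closure_of] by metis
  qed
  then obtain f where f: "\<And>p. p \<in> P \<Longrightarrow> continuous_map X euclideanreal (f p)"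
    "\<And>p. p \<in> P \<Longrightarrow> f p ` (X closure_of fst p) \<subseteq> {0}" "\<And>p. p \<in> P \<Longrightarrow> f p ` (topspace X - snd p) \<subseteq> {1}"
    by metis
  \<comment> \<open>\<open>from_nat_into\<close> enumerates \<open>P\<close> only when it is
    nonempty; the zero function is a placeholder that keeps \<open>F n\<close> continuous
    otherwise.\<close>
  define F where "F = (\<lambda>n::nat. if P = {} then (\<lambda>_. 0) else f (from_nat_into P n))"
  have Fc: "continuous_map X euclideanreal (F n)" for n
    unfolding F_def using f(1)[of "from_nat_into P n"] from_nat_into[of P n] by simp
  have sep: "\<exists>n. F n x = 0 \<and> (\<forall>y\<in>topspace X - W. F n y = 1)" if W: "openin X W" "x \<in> W" for W x
  proof -
    obtain V where V: "V \<in> \<B>" "x \<in> V" "V \<subseteq> W" using base W by blast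
    \<comment> \<open>Regularity puts a closed set between \<open>x\<close> and \<open>V\<close>, so
      a basic set \<open>U\<close> around \<open>x\<close> inside it has its closure in
      \<open>V\<close> and the pair belongs to \<open>P\<close>.\<close>
    obtain U' C where U': "openin X U'" "closedin X C" "x \<in> U'" "U' \<subseteq> C" "C \<subseteq> V"
      using reg V \<B>(2) unfolding neighbourhood_base_of_closedin[symmetric] neighbourhood_base_of by metis
    obtain U where U: "U \<in> \<B>" "x \<in> U" "U \<subseteq> U'" using base U' by metis
    have "X closure_of U \<subseteq> V" using U U' by (metis closure_of_minimal subset_trans)
    then have p: "(U, V) \<in> P" using U V P_def by auto
    then obtain n where n: "from_nat_into P n = (U, V)"
      using \<open>countable P\<close> by (metis from_nat_into_to_nat_on)
    have "x \<in> X closure_of U" using U \<B>(2) closure_of_subset openin_subset by (metis subsetD)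
    then have "F n x = 0" "\<forall>y\<in>topspace X - W. F n y = 1"
      using f(2,3)[OF p] V p unfolding F_def n by auto
    then show ?thesis by blast
  qed
  define \<phi> where "\<phi> = (\<lambda>x n. F n x)"
  have cont: "continuous_map X euclidean \<phi>"
    unfolding euclidean_product_topology[symmetric] continuous_map_componentwise_UNIV \<phi>_def using Fc by simp
  have inj: "inj_on \<phi> (topspace X)"
  proof (rule inj_onI)
    fix x y assume xy: "x \<in> topspace X" "y \<in> topspace X" "\<phi> x = \<phi> y"
    show "x = y"
    proof (rule ccontr)
      assume "x \<noteq> y"
      then obtain W where "openin X W" "x \<in> W" "y \<notin> W" using t1 xy unfolding t1_space_def by metis
      then obtain n where "F n x = 0" "F n y = 1" using sep[of W x] xy by auto
      then show False using fun_cong[OF xy(3), of n] by (simp add: \<phi>_def)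
    qed
  qed
  let ?Y = "subtopology euclidean (\<phi> ` topspace X)"
  have "open_map X ?Y \<phi>"
    unfolding open_map_def
  proof (intro allI impI)
    fix W assume W: "openin X W"
    have "\<exists>T. openin ?Y T \<and> z \<in> T \<and> T \<subseteq> \<phi> ` W" if z: "z \<in> \<phi> ` W" for z
    proof -
      obtain x where x: "x \<in> W" "z = \<phi> x" using z by auto
      obtain n where n: "F n x = 0" "\<forall>y\<in>topspace X - W. F n y = 1" using sep[OF W x(1)] by blast
      have "open ((\<lambda>z::nat\<Rightarrow>real. z n) -` {..<1/2})"
        by (intro open_vimage) (auto intro: continuous_on_product_coordinates)
      then have "openin ?Y ((\<lambda>z. z n) -` {..<1/2} \<inter> \<phi> ` topspace X)"
        by (auto simp: openin_subtopology)
      moreover have "z \<in> (\<lambda>z. z n) -` {..<1/2} \<inter> \<phi> ` topspace X"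
        using x n W openin_subset by (fastforce simp: \<phi>_def)
      moreover have "(\<lambda>z. z n) -` {..<1/2} \<inter> \<phi> ` topspace X \<subseteq> \<phi> ` W"
        using n by (force simp: \<phi>_def)
      ultimately show ?thesis by blast
    qed
    then show "openin ?Y (\<phi> ` W)" using openin_subopen by blast
  qed
  then have "embedding_map X ?Y \<phi>"
    using inj cont by (intro injective_open_imp_embedding_map) (auto simp: continuous_map_in_subtopology)
  then have "X homeomorphic_space subtopology ?Y (\<phi> ` topspace X)"
    by (rule embedding_map_imp_homeomorphic_space)
  moreover have "metrizable_space (subtopology ?Y (\<phi> ` topspace X))"
    by (intro metrizable_space_subtopology metrizable_space_euclidean)
  ultimately show ?thesis using homeomorphic_metrizable_space by blast
qed

section \<open>Topological groups\<close>

text \<open>T1 is what closed metrizable pieces yield directly; the Hausdorff property and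
  regularity are then consequences of the group structure.\<close>

locale t1_group = group G for G (structure) +
  fixes T :: "'a topology"
  assumes topspace_eq: "topspace T = carrier G"
    and cont_mult: "continuous_map (prod_topology T T) T (\<lambda>(x, y). x \<otimes> y)"
    and cont_inv: "continuous_map T T (\<lambda>x. inv x)"
    and t1: "t1_space T"
begin

lemma continuous_map_mult:
  "continuous_map X T f \<Longrightarrow> continuous_map X T g \<Longrightarrow> continuous_map X T (\<lambda>x. f x \<otimes> g x)"
  using continuous_map_compose[OF _ cont_mult, of X "\<lambda>x. (f x, g x)"]
  by (simp add: continuous_map_paired o_def)

lemma continuous_map_inv: "continuous_map X T f \<Longrightarrow> continuous_map X T (\<lambda>x. inv (f x))"
  using continuous_map_compose[OF _ cont_inv, of X f] by (simp add: o_def)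

lemma continuous_map_lmult: "a \<in> carrier G \<Longrightarrow> continuous_map T T (\<lambda>x. a \<otimes> x)"
  by (intro continuous_map_mult) (auto simp: topspace_eq)

lemma continuous_map_rmult: "a \<in> carrier G \<Longrightarrow> continuous_map T T (\<lambda>x. x \<otimes> a)"
  by (intro continuous_map_mult) (auto simp: topspace_eq)

lemma limitin_mult:
  assumes "limitin T f x F" "limitin T g y F"
  shows "limitin T (\<lambda>n. f n \<otimes> g n) (x \<otimes> y) F"
proof -
  have "limitin (prod_topology T T) (\<lambda>n. (f n, g n)) (x, y) F"
    using assms by (simp add: limitin_pairwise o_def)
  then show ?thesis using continuous_map_limit[OF cont_mult] by (fastforce simp: o_def)
qed

lemma compactin_set_mult:
  assumes "compactin T A" "compactin T B" shows "compactin T (A <#> B)"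
proof -
  have "compactin (prod_topology T T) (A \<times> B)" using assms compactin_Times by blast
  then have "compactin T ((\<lambda>(x, y). x \<otimes> y) ` (A \<times> B))" using cont_mult image_compactin by blast
  moreover have "(\<lambda>(x, y). x \<otimes> y) ` (A \<times> B) = A <#> B" unfolding set_mult_def by auto
  ultimately show ?thesis by simp
qed

lemma compactin_set_inv:
  assumes "compactin T A" shows "compactin T (set_inv A)"
proof -
  have "(\<lambda>x. inv x) ` A = set_inv A" unfolding SET_INV_def by auto
  then show ?thesis using image_compactin[OF assms cont_inv] by simp
qed

lemma set_multI: "a \<in> A \<Longrightarrow> b \<in> B \<Longrightarrow> a \<otimes> b \<in> A <#> B"
  unfolding set_mult_def by blast

lemma set_invI: "a \<in> A \<Longrightarrow> inv a \<in> set_inv A"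
  unfolding SET_INV_def by blast

lemma openin_multD:
  assumes "openin T U" "x \<in> carrier G" "y \<in> carrier G" "x \<otimes> y \<in> U"
  obtains P Q where "openin T P" "openin T Q" "x \<in> P" "y \<in> Q" "\<And>p q. p \<in> P \<Longrightarrow> q \<in> Q \<Longrightarrow> p \<otimes> q \<in> U"
proof -
  let ?S = "{z \<in> topspace (prod_topology T T). (\<lambda>(x, y). x \<otimes> y) z \<in> U}"
  have "openin (prod_topology T T) ?S"
    using openin_continuous_map_preimage[OF cont_mult assms(1)] .
  moreover have "(x, y) \<in> ?S"
    using assms by (simp add: topspace_eq)
  ultimately have "\<exists>P Q. openin T P \<and> openin T Q \<and> x \<in> P \<and> y \<in> Q \<and> P \<times> Q \<subseteq> ?S"
    unfolding openin_prod_topology_alt by (elim allE impE)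
  then obtain P Q where "openin T P" "openin T Q" "x \<in> P" "y \<in> Q" "P \<times> Q \<subseteq> ?S" by blast
  then show thesis by (intro that[of P Q]) auto
qed

lemma openin_preimage_lmult: "openin T U \<Longrightarrow> a \<in> carrier G \<Longrightarrow> openin T {x \<in> carrier G. a \<otimes> x \<in> U}"
  using openin_continuous_map_preimage[OF continuous_map_lmult, of a U] by (simp add: topspace_eq)

lemma openin_preimage_inv: "openin T U \<Longrightarrow> openin T {x \<in> carrier G. inv x \<in> U}"
  using openin_continuous_map_preimage[OF cont_inv, of U] by (simp add: topspace_eq)

lemma Hausdorff: "Hausdorff_space T"
proof -
  let ?d = "\<lambda>z. inv (fst z) \<otimes> snd z"
  have "continuous_map (prod_topology T T) T ?d"
    by (intro continuous_map_mult continuous_map_inv continuous_map_fst continuous_map_snd)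
  moreover have "closedin T {\<one>}" using t1 by (simp add: t1_space_closedin_singleton topspace_eq)
  ultimately have "closedin (prod_topology T T) {z \<in> topspace (prod_topology T T). ?d z \<in> {\<one>}}"
    by (rule closedin_continuous_map_preimage)
  moreover have "inv a \<otimes> b = \<one> \<longleftrightarrow> a = b" if "a \<in> carrier G" "b \<in> carrier G" for a b
    using inv_solve_left[of \<one> a b] that by auto
  then have "{z \<in> topspace (prod_topology T T). ?d z \<in> {\<one>}} = (\<lambda>x. (x, x)) ` topspace T"
    by (auto simp: topspace_eq image_iff)
  ultimately show ?thesis by (simp add: Hausdorff_space_closedin_diagonal)
qed

text \<open>Continuity of multiplication is applied twice at \<open>x\<close> and the identity, and
  \<open>V\<close> is made to contain inverses of its elements in both neighbourhoods. The first
  form serves regularity, the second the construction of a base from translates.\<close>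

lemma openin_divide:
  assumes "openin T U" "x \<in> U"
  obtains V where "openin T V" "\<one> \<in> V" "\<And>v w. v \<in> V \<Longrightarrow> w \<in> V \<Longrightarrow> x \<otimes> v \<otimes> inv w \<in> U"
    "\<And>v w. v \<in> V \<Longrightarrow> w \<in> V \<Longrightarrow> x \<otimes> inv v \<otimes> w \<in> U"
proof -
  have xc: "x \<in> carrier G" using assms openin_subset topspace_eq by blast
  then have "x \<otimes> \<one> \<in> U" using assms by simp
  then obtain P Q where PQ: "openin T P" "openin T Q" "x \<in> P" "\<one> \<in> Q" "\<And>p q. p \<in> P \<Longrightarrow> q \<in> Q \<Longrightarrow> p \<otimes> q \<in> U"
    using openin_multD[OF assms(1) xc one_closed] by metis
  have "x \<otimes> \<one> \<in> P" using xc PQ by simp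
  then obtain P' Q' where PQ': "openin T P'" "openin T Q'" "x \<in> P'" "\<one> \<in> Q'" "\<And>p q. p \<in> P' \<Longrightarrow> q \<in> Q' \<Longrightarrow> p \<otimes> q \<in> P"
    using openin_multD[OF PQ(1) xc one_closed] by metis
  let ?V = "Q \<inter> Q' \<inter> {x \<in> carrier G. inv x \<in> Q \<inter> Q'}"
  show thesis
  proof
    show "openin T ?V" using PQ PQ' openin_preimage_inv by blast
    show "\<one> \<in> ?V" using PQ PQ' by simp
    show "x \<otimes> v \<otimes> inv w \<in> U" "x \<otimes> inv v \<otimes> w \<in> U" if "v \<in> ?V" "w \<in> ?V" for v w
      using that PQ PQ' by auto
  qed
qed

lemma openin_lcoset:
  assumes "openin T U" "a \<in> carrier G" shows "openin T (a <# U)"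
proof -
  have "U \<subseteq> carrier G" using assms openin_subset topspace_eq by blast
  have "a <# U = {x \<in> carrier G. inv a \<otimes> x \<in> U}"
  proof (intro subset_antisym subsetI)
    fix x assume "x \<in> a <# U"
    then obtain u where "u \<in> U" "x = a \<otimes> u" unfolding l_coset_def by blast
    then show "x \<in> {x \<in> carrier G. inv a \<otimes> x \<in> U}"
      using assms \<open>U \<subseteq> carrier G\<close> by (auto simp: inv_solve_left m_assoc[symmetric])
  next
    fix x assume "x \<in> {x \<in> carrier G. inv a \<otimes> x \<in> U}"
    then have "x = a \<otimes> (inv a \<otimes> x)" "inv a \<otimes> x \<in> U" using assms by (auto simp: m_assoc[symmetric])
    then show "x \<in> a <# U" unfolding l_coset_def by blast
  qed
  then show ?thesis using openin_preimage_lmult[OF assms(1), of "inv a"] assms by simp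
qed

text \<open>If y lies in the closure of \<open>a <# V\<close>, then the neighbourhood
  \<open>y <# V\<close> of y meets \<open>a <# V\<close>, so y has the form
  \<open>a \<otimes> v \<otimes> inv w\<close>, which the choice of \<open>V\<close> keeps out of
  \<open>C\<close>.\<close>

lemma regular: "regular_space T"
  unfolding regular_space
proof (intro allI impI)
  fix C a assume C: "closedin T C \<and> a \<in> topspace T - C"
  then have ac: "a \<in> carrier G" using topspace_eq by simp
  have "openin T (topspace T - C)" "a \<in> topspace T - C" using C by auto
  then obtain V where V: "openin T V" "\<one> \<in> V" "\<And>v w. v \<in> V \<Longrightarrow> w \<in> V \<Longrightarrow> a \<otimes> v \<otimes> inv w \<in> topspace T - C"
    using openin_divide by metis
  have Vc: "V \<subseteq> carrier G" using V openin_subset topspace_eq by blast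
  have "a \<in> a <# V" using V ac unfolding l_coset_def by force
  moreover have "disjnt C (T closure_of (a <# V))"
    unfolding disjnt_iff
  proof (intro allI notI)
    fix y assume y: "y \<in> C \<and> y \<in> T closure_of (a <# V)"
    then have yc: "y \<in> carrier G" using C closedin_subset topspace_eq by blast
    have "y \<in> y <# V" using V yc unfolding l_coset_def by force
    then have "(a <# V) \<inter> (y <# V) \<noteq> {}"
      using y openin_lcoset[OF V(1) yc] unfolding in_closure_of by blast
    then obtain v w where vw: "v \<in> V" "w \<in> V" "a \<otimes> v = y \<otimes> w" unfolding l_coset_def by auto
    then have "y = a \<otimes> v \<otimes> inv w" using yc ac Vc by (simp add: inv_solve_right subset_iff)
    then show False using V(3)[OF vw(1,2)] y by simp
  qed
  ultimately show "\<exists>U. openin T U \<and> a \<in> U \<and> disjnt C (T closure_of U)"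
    using openin_lcoset[OF V(1) ac] by blast
qed

text \<open>The separable case of the Birkhoff-Kakutani theorem. Translates of a countable base at
  the identity by a countable dense set form a base: density gives \<open>d\<close> with
  \<open>inv d \<otimes> x \<in> B\<close>, and then \<open>d \<otimes> b\<close> equals
  \<open>x \<otimes> inv (inv d \<otimes> x) \<otimes> b\<close>, which is close to
  \<open>x\<close>.\<close>

theorem separable_first_countable_imp_metrizable_space:
  assumes sep: "separable_space T"
    and base: "countable \<B>" "\<And>V. V \<in> \<B> \<Longrightarrow> openin T V \<and> \<one> \<in> V"
      "\<And>U. openin T U \<Longrightarrow> \<one> \<in> U \<Longrightarrow> \<exists>V\<in>\<B>. V \<subseteq> U"
  shows "metrizable_space T"
proof (rule regular_second_countable_imp_metrizable_space[OF regular t1])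
  obtain D where D: "countable D" "D \<subseteq> carrier G" "T closure_of D = carrier G"
    using sep unfolding separable_space_def topspace_eq by blast
  show "second_countable T"
    unfolding second_countable_def
  proof (intro exI conjI ballI allI impI)
    let ?\<C> = "(\<lambda>(d, V). d <# V) ` (D \<times> \<B>)"
    show "countable ?\<C>" using D base by blast
    show "openin T W" if "W \<in> ?\<C>" for W using that base D openin_lcoset by auto
    fix U x assume U: "openin T U \<and> x \<in> U"
    then have xc: "x \<in> carrier G" using openin_subset topspace_eq by blast
    obtain V where V: "openin T V" "\<one> \<in> V" "\<And>v w. v \<in> V \<Longrightarrow> w \<in> V \<Longrightarrow> x \<otimes> inv v \<otimes> w \<in> U"
      using openin_divide U by metis
    obtain B where B: "B \<in> \<B>" "B \<subseteq> V" using base V by blast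
    have Bo: "openin T B" "\<one> \<in> B" using base B by auto
    have Bc: "B \<subseteq> carrier G" using Bo openin_subset topspace_eq by blast
    let ?W = "{y \<in> carrier G. inv y \<otimes> x \<in> B}"
    have W: "openin T ?W"
    proof -
      have c: "continuous_map T T (\<lambda>y. inv y \<otimes> x)"
        by (intro continuous_map_mult cont_inv) (simp add: xc topspace_eq)
      then show ?thesis using openin_continuous_map_preimage[OF c Bo(1)] by (simp add: topspace_eq)
    qed
    have "x \<in> ?W" using xc Bo by simp
    moreover have "\<forall>W. x \<in> W \<and> openin T W \<longrightarrow> (\<exists>d. d \<in> D \<and> d \<in> W)"
      using xc D(3) in_closure_of[of x T D] by simp
    ultimately have "\<exists>d. d \<in> D \<and> d \<in> ?W" using W by (elim allE[of _ ?W]) (rule mp, assumption, rule conjI)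
    then obtain d where d: "d \<in> D" "inv d \<otimes> x \<in> B" by auto
    have dc: "d \<in> carrier G" using d D by auto
    have "x = d \<otimes> (inv d \<otimes> x)" using dc xc by (simp add: m_assoc[symmetric])
    then have "x \<in> d <# B" using d unfolding l_coset_def by blast
    moreover have "d <# B \<subseteq> U"
    proof
      fix y assume "y \<in> d <# B"
      then obtain b where b: "b \<in> B" "y = d \<otimes> b" unfolding l_coset_def by blast
      have "x \<otimes> inv (inv d \<otimes> x) \<otimes> b = d \<otimes> b"
        using xc dc b Bc by (simp add: inv_mult_group m_assoc[symmetric] subset_iff)
      then show "y \<in> U" using V(3)[of "inv d \<otimes> x" b] d b B by auto
    qed
    ultimately show "\<exists>V\<in>?\<C>. x \<in> V \<and> V \<subseteq> U" using d B by blast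
  qed
qed

end

section \<open>Sequences and bases in metrizable spaces\<close>

text \<open>Inclusion for all large indices, rather than for one, allows a common index for finitely
  many pieces. The point may lie outside the space, as the identity may lie outside a piece.\<close>

lemma metrizable_space_decreasing_base:
  assumes "metrizable_space X"
  obtains V :: "nat \<Rightarrow> 'a set" where "\<And>k. openin X (V k)" "\<And>k. x \<in> topspace X \<Longrightarrow> x \<in> V k"
    "\<And>U. openin X U \<Longrightarrow> x \<in> U \<Longrightarrow> \<exists>k. \<forall>l\<ge>k. V l \<subseteq> U"
proof -
  obtain M d where "Metric_space M d" and X: "X = Metric_space.mtopology M d"
    using assms unfolding metrizable_space_def by blast
  then interpret Metric_space M d by simp
  show thesis
  proof
    show "openin X (mball x (1 / Suc k))" for k unfolding X by (rule openin_mball)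
    show "x \<in> mball x (1 / Suc k)" if "x \<in> topspace X" for k using that unfolding X by simp
    fix U assume "openin X U" "x \<in> U"
    then obtain r where r: "r > 0" "mball x r \<subseteq> U" unfolding X openin_mtopology by blast
    then obtain k where k: "1 / Suc k < r" using nat_approx_posE by blast
    have "mball x (1 / Suc l) \<subseteq> U" if "l \<ge> k" for l
    proof -
      have "1 / real (Suc l) \<le> 1 / real (Suc k)" using that by (intro divide_left_mono) auto
      then have "mball x (1 / Suc l) \<subseteq> mball x r" using k by (intro mball_subset_concentric) linarith
      then show ?thesis using r by blast
    qed
    then show "\<exists>k. \<forall>l\<ge>k. mball x (1 / Suc l) \<subseteq> U" by blast
  qed
qed

lemma metrizable_space_diagonal_sequence:
  assumes X: "metrizable_space X" and x: "\<And>n. x \<in> X closure_of (S n)"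
  obtains \<sigma> :: "nat \<Rightarrow> 'a" where "\<And>n. \<sigma> n \<in> S n" "limitin X \<sigma> x sequentially"
proof -
  have xt: "x \<in> topspace X" using x in_closure_of by fast
  obtain V :: "nat \<Rightarrow> 'a set" where V: "\<And>k. openin X (V k)" "\<And>k. x \<in> topspace X \<Longrightarrow> x \<in> V k"
    "\<And>U. openin X U \<Longrightarrow> x \<in> U \<Longrightarrow> \<exists>k. \<forall>l\<ge>k. V l \<subseteq> U"
    using metrizable_space_decreasing_base[OF X] by blast
  have "\<exists>y. y \<in> S n \<and> y \<in> V n" for n
    using x[of n] V(1)[of n] V(2)[OF xt, of n] unfolding in_closure_of by blast
  then obtain \<sigma> where \<sigma>: "\<And>n. \<sigma> n \<in> S n \<and> \<sigma> n \<in> V n" by metis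
  have "limitin X \<sigma> x sequentially"
    unfolding limitin_def eventually_sequentially
  proof (intro conjI allI impI xt)
    fix U assume "openin X U \<and> x \<in> U"
    then obtain k where "\<forall>l\<ge>k. V l \<subseteq> U" using V(3) by blast
    then show "\<exists>N. \<forall>n\<ge>N. \<sigma> n \<in> U" using \<sigma> by blast
  qed
  with \<sigma> that show thesis by blast
qed

lemma metrizable_subspace_diagonal_sequence:
  assumes C: "metrizable_space (subtopology X C)" "closedin X C"
    and S: "\<And>n. S n \<subseteq> C" "\<And>n. x \<in> X closure_of (S n)"
  obtains \<sigma> :: "nat \<Rightarrow> 'a" where "\<And>n. \<sigma> n \<in> S n" "limitin X \<sigma> x sequentially"
proof -
  have "x \<in> C" using S C(2) closure_of_minimal by (metis subsetD)
  then have "x \<in> subtopology X C closure_of (S n)" for n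
    using S unfolding closure_of_subtopology by (simp add: inf_absorb2)
  then obtain \<sigma> where "\<And>n. \<sigma> n \<in> S n" "limitin (subtopology X C) \<sigma> x sequentially"
    using metrizable_space_diagonal_sequence[OF C(1), of x S] by blast
  then show thesis using that limitin_subtopology by metis
qed

text \<open>This passes from a finite union of pieces to a single metrizable piece, where closure
  points are limits of sequences.\<close>

lemma in_closure_of_finite_Union:
  assumes "finite I" "x \<in> X closure_of (\<Union>i\<in>I. S i)"
  obtains i where "i \<in> I" "x \<in> X closure_of (S i)"
proof -
  have "X closure_of (\<Union>i\<in>I. S i) = (\<Union>i\<in>I. X closure_of S i)"
    using assms(1) by (induction I) auto
  then show thesis using assms(2) that by auto
qed

section \<open>Groups with the weak topology of countably many metrizable subspaces\<close>

locale M_omega_t1_group = t1_group +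
  fixes K :: "nat \<Rightarrow> 'a set"
  assumes closed_K: "closedin T (K n)"
    and metrizable_K: "metrizable_space (subtopology T (K n))"
    and cover_K: "(\<Union>n. K n) = carrier G"
    and openin_K: "U \<subseteq> carrier G \<Longrightarrow> (\<And>n. openin (subtopology T (K n)) (U \<inter> K n)) \<Longrightarrow> openin T U"
begin

lemma closedin_K:
  assumes "F \<subseteq> carrier G" "\<And>n. closedin T (F \<inter> K n)"
  shows "closedin T F"
proof -
  have "openin (subtopology T (K n)) ((carrier G - F) \<inter> K n)" for n
  proof -
    have "openin T (topspace T - F \<inter> K n)" using assms by blast
    then have "openin (subtopology T (K n)) ((topspace T - F \<inter> K n) \<inter> K n)"
      by (auto simp: openin_subtopology)
    moreover have "(topspace T - F \<inter> K n) \<inter> K n = (carrier G - F) \<inter> K n"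
      by (auto simp: topspace_eq)
    ultimately show ?thesis by simp
  qed
  then have "openin T (carrier G - F)" by (intro openin_K) auto
  then show ?thesis using assms(1) by (simp add: closedin_def topspace_eq)
qed

definition M :: "nat \<Rightarrow> 'a set" where "M n = (\<Union>i\<le>n. K i)"

lemma closed_M: "closedin T (M n)"
  unfolding M_def by (intro closedin_Union) (auto simp: closed_K)

lemma M_mono: "m \<le> n \<Longrightarrow> M m \<subseteq> M n"
  unfolding M_def by (meson UN_mono atMost_subset_iff order_refl)

lemma K_subset_M: "n \<le> m \<Longrightarrow> K n \<subseteq> M m"
  unfolding M_def by auto

lemma closedin_finite: "finite F \<Longrightarrow> F \<subseteq> carrier G \<Longrightarrow> closedin T F"
  using t1 topspace_eq by (simp add: t1_space_closedin_finite)

text \<open>Otherwise choose \<open>y n\<close> in \<open>D - M n\<close>. Each piece contains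
  \<open>y m\<close> for finitely many m only, so every subset of the range is closed; yet the range
  is infinite and must accumulate in the compact set \<open>D\<close>.\<close>

lemma compactin_subset_M:
  assumes "compactin T D"
  obtains n where "D \<subseteq> M n"
proof (rule ccontr)
  assume "\<not> thesis"
  then have "\<exists>y. y \<in> D - M n" for n using that by blast
  then obtain y where y: "\<And>n. y n \<in> D - M n" by metis
  have Dc: "D \<subseteq> carrier G" using assms compactin_subset_topspace topspace_eq by blast
  have closed: "closedin T S" if S: "S \<subseteq> range y" for S
  proof (rule closedin_K)
    show "S \<subseteq> carrier G" using S y Dc by auto
    fix n
    have "y m \<in> K n \<longrightarrow> m < n" for m
      using y[of m] K_subset_M[of n m] by (metis DiffD2 not_less subsetD)
    then have "S \<inter> K n \<subseteq> y ` {..<n}" using S by auto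
    then have "finite (S \<inter> K n)" by (rule finite_subset) simp
    then show "closedin T (S \<inter> K n)" using closedin_finite S y Dc by (metis closed_K closedin_subset inf.coboundedI2 topspace_eq)
  qed
  have "infinite (range y)"
  proof
    assume "finite (range y)"
    moreover have "\<exists>n. z \<in> M n" if z: "z \<in> range y" for z
    proof -
      have "z \<in> (\<Union>n. K n)" using z y Dc unfolding cover_K by blast
      then show ?thesis using K_subset_M by blast
    qed
    then obtain f where f: "\<And>z. z \<in> range y \<Longrightarrow> z \<in> M (f z)" by metis
    ultimately have "f (y m) \<le> Max (f ` range y)" for m by simp
    then have "y m \<in> M (Max (f ` range y))" for m using f M_mono by blast
    then show False using y by blast
  qed
  then obtain z where z: "z \<in> T derived_set_of (range y)"
    using compactin_imp_Bolzano_Weierstrass[OF assms, of "range y"] y by blast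
  have op: "openin T (topspace T - (range y - {z}))" using closed[of "range y - {z}"] by auto
  have zin: "z \<in> topspace T - (range y - {z})" using z unfolding derived_set_of_def by simp
  have "\<And>W. openin T W \<Longrightarrow> z \<in> W \<Longrightarrow> \<exists>w. w \<noteq> z \<and> w \<in> range y \<and> w \<in> W"
    using z unfolding in_derived_set_of by simp
  from this[OF op zin] show False by blast
qed

text \<open>The closure is taken within one \<open>M j\<close> at a time, so that each of these
  points is the limit of a sequence outside \<open>M n\<close>; the closure of the whole complement
  of \<open>M n\<close> would not provide such a sequence directly.\<close>

definition outer_limits :: "nat \<Rightarrow> 'a set" where
  "outer_limits n = (\<Union>j. T closure_of (M j - M n))"

lemma outer_limits_antimono: "m \<le> n \<Longrightarrow> outer_limits n \<subseteq> outer_limits m"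
  unfolding outer_limits_def using M_mono by (intro UN_mono closure_of_mono) auto

lemma outer_limits_sequence:
  assumes "x \<in> outer_limits n"
  obtains s :: "nat \<Rightarrow> 'a" where "\<And>m. s m \<in> carrier G - M n" "limitin T s x sequentially"
proof -
  obtain j where "x \<in> T closure_of (M j - M n)" using assms outer_limits_def by auto
  moreover have "M j - M n = (\<Union>i\<in>{..j}. K i - M n)" unfolding M_def by auto
  ultimately have "x \<in> T closure_of (\<Union>i\<in>{..j}. K i - M n)" by simp
  then obtain i where i: "x \<in> T closure_of (K i - M n)"
    using in_closure_of_finite_Union[of "{..j}" x T "\<lambda>i. K i - M n"] by auto
  obtain s :: "nat \<Rightarrow> 'a" where "\<And>m. s m \<in> K i - M n" "limitin T s x sequentially"
    by (rule metrizable_subspace_diagonal_sequence[OF metrizable_K closed_K, of "\<lambda>_. K i - M n" i x]) (use i in auto)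
  then show thesis using that cover_K by blast
qed

definition fan :: "(nat \<Rightarrow> nat \<Rightarrow> 'a) \<Rightarrow> bool" where
  "fan t \<longleftrightarrow> (\<forall>n. range (t n) \<subseteq> carrier G) \<and> (\<forall>n. limitin T (t n) \<one> sequentially) \<and>
     (\<forall>D. compactin T D \<longrightarrow> (\<exists>N. \<forall>n\<ge>N. \<forall>m. t n m \<notin> D))"

text \<open>Sequences outside \<open>M n\<close> with limit \<open>x n\<close> are translated by
  \<open>inv (x n)\<close>. If \<open>D\<close> is compact, so is its product with the set of all
  \<open>x n\<close> and the identity, and this product lies in some \<open>M N\<close>. A point
  \<open>t n m\<close> in \<open>D\<close> would put \<open>s n m\<close>, which is outside
  \<open>M n\<close>, into \<open>M N\<close>, so n is less than N.\<close>

lemma fan_from_outer_limits: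
  assumes x: "\<And>n. x n \<in> outer_limits n" "limitin T x \<one> sequentially"
  shows "\<exists>t. fan t"
proof -
  have xc: "x n \<in> carrier G" for n
    using x(1)[of n] closure_of_subset_topspace[of T] unfolding outer_limits_def topspace_eq by blast
  have "\<exists>s. (\<forall>m. s m \<in> carrier G - M n) \<and> limitin T s (x n) sequentially" for n
    using outer_limits_sequence[OF x(1)] by metis
  then obtain s where s: "\<And>n m. s n m \<in> carrier G - M n" "\<And>n. limitin T (s n) (x n) sequentially"
    by metis
  define t where "t = (\<lambda>n m. inv (x n) \<otimes> s n m)"
  have "fan t"
    unfolding fan_def
  proof (intro conjI allI impI)
    fix n
    show "range (t n) \<subseteq> carrier G" using s xc unfolding t_def by auto
    have "limitin T (\<lambda>m. inv (x n)) (inv (x n)) sequentially" using xc by (simp add: topspace_eq)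
    then have "limitin T (t n) (inv (x n) \<otimes> x n) sequentially"
      unfolding t_def using s(2) by (rule limitin_mult)
    then show "limitin T (t n) \<one> sequentially" using xc by simp
  next
    fix D assume D: "compactin T D"
    have "compactin T (insert \<one> (range x))"
      by (rule compactin_sequence_with_limit[OF x(2)]) (use xc topspace_eq in auto)
    then have "compactin T (insert \<one> (range x) <#> D)" using D compactin_set_mult by blast
    then obtain N where N: "insert \<one> (range x) <#> D \<subseteq> M N" by (rule compactin_subset_M)
    have "t n m \<notin> D" if "n \<ge> N" for n m
    proof
      assume "t n m \<in> D"
      then have "x n \<otimes> t n m \<in> insert \<one> (range x) <#> D" by (intro set_multI) auto
      then have "x n \<otimes> t n m \<in> M N" using N by (rule rev_subsetD)
      moreover have "x n \<otimes> t n m = s n m" using xc s unfolding t_def by (auto simp: m_assoc[symmetric])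
      ultimately show False using s(1)[of n m] M_mono[OF that] by auto
    qed
    then show "\<exists>N. \<forall>n\<ge>N. \<forall>m. t n m \<notin> D" by blast
  qed
  then show ?thesis by blast
qed

lemma countable_base_of_open_subset_M:
  assumes W: "openin T W" "\<one> \<in> W" "W \<subseteq> M n"
  obtains \<B> where "countable \<B>" "\<And>V. V \<in> \<B> \<Longrightarrow> openin T V \<and> \<one> \<in> V"
      "\<And>U. openin T U \<Longrightarrow> \<one> \<in> U \<Longrightarrow> \<exists>V\<in>\<B>. V \<subseteq> U"
proof -
  have "\<exists>V :: nat \<Rightarrow> 'a set. (\<forall>k. openin (subtopology T (K i)) (V k)) \<and> (\<one> \<in> K i \<longrightarrow> (\<forall>k. \<one> \<in> V k)) \<and>
      (\<forall>U. openin (subtopology T (K i)) U \<longrightarrow> \<one> \<in> U \<longrightarrow> (\<exists>k. \<forall>l\<ge>k. V l \<subseteq> U))" for i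
  proof -
    obtain V :: "nat \<Rightarrow> 'a set" where V: "\<And>k. openin (subtopology T (K i)) (V k)"
      "\<And>k. \<one> \<in> topspace (subtopology T (K i)) \<Longrightarrow> \<one> \<in> V k"
      "\<And>U. openin (subtopology T (K i)) U \<Longrightarrow> \<one> \<in> U \<Longrightarrow> \<exists>k. \<forall>l\<ge>k. V l \<subseteq> U"
      by (rule metrizable_space_decreasing_base[OF metrizable_K[of i], of \<one>]) blast
    then show ?thesis by (intro exI[of _ V]) (simp add: topspace_eq)
  qed
  then obtain V :: "nat \<Rightarrow> nat \<Rightarrow> 'a set" where V: "\<And>i k. openin (subtopology T (K i)) (V i k)"
    "\<And>i k. \<one> \<in> K i \<Longrightarrow> \<one> \<in> V i k"
    "\<And>i U. openin (subtopology T (K i)) U \<Longrightarrow> \<one> \<in> U \<Longrightarrow> (\<exists>k. \<forall>l\<ge>k. V i l \<subseteq> U)"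
    by metis
  \<comment> \<open>Sets open in a piece are not open in \<open>G\<close>, so neighbourhoods are
    obtained by removing from \<open>W\<close> the closed rest of each piece, and the whole piece if
    it misses the identity. Only finitely many pieces matter because
    \<open>W \<subseteq> M n\<close>.\<close>
  define B where "B = (\<lambda>k. W - (\<Union>i\<le>n. K i - (if \<one> \<in> K i then V i k else {})))"
  have Bo: "openin T (B k)" for k
  proof -
    have "closedin T (K i - (if \<one> \<in> K i then V i k else {}))" for i
    proof -
      have "topspace (subtopology T (K i)) = K i" using closed_K closedin_subset by auto
      then have "closedin (subtopology T (K i)) (K i - V i k)" using V(1) by (metis openin_closedin_eq)
      then have "closedin T (K i - V i k)" using closed_K closedin_trans_full by blast
      then show ?thesis using closed_K by simp
    qed
    then have "closedin T (\<Union>i\<le>n. K i - (if \<one> \<in> K i then V i k else {}))"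
      by (intro closedin_Union) auto
    then show ?thesis unfolding B_def using W by blast
  qed
  show thesis
  proof
    show "countable (range B)" by simp
    show "openin T V \<and> \<one> \<in> V" if "V \<in> range B" for V
      using that Bo W V(2) unfolding B_def by auto
    fix U assume U: "openin T U" "\<one> \<in> U"
    have "\<exists>k. \<forall>l\<ge>k. \<one> \<in> K i \<longrightarrow> V i l \<subseteq> U" for i
    proof (cases "\<one> \<in> K i")
      case True
      have "openin (subtopology T (K i)) (U \<inter> K i)" using U by (auto simp: openin_subtopology)
      then show ?thesis using V(3)[of i "U \<inter> K i"] True U by auto
    qed auto
    then obtain k where k: "\<And>i l. l \<ge> k i \<Longrightarrow> \<one> \<in> K i \<Longrightarrow> V i l \<subseteq> U" by metis
    define k0 where "k0 = Max (k ` {..n})"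
    have "B k0 \<subseteq> U"
    proof
      fix y assume y: "y \<in> B k0"
      then obtain i where i: "i \<le> n" "y \<in> K i" using W unfolding B_def M_def by blast
      then have "\<one> \<in> K i" "y \<in> V i k0" using y unfolding B_def by (auto split: if_splits)
      moreover have "k i \<le> k0" unfolding k0_def using i by simp
      ultimately show "y \<in> U" using k by blast
    qed
    then show "\<exists>V\<in>range B. V \<subseteq> U" by blast
  qed
qed

text \<open>
  Unless points \<open>x n\<close> of \<open>outer_limits n\<close> converge to the identity, removing finitely many closed
  sets from some \<open>M n\<close> leaves an open neighbourhood of the identity, and \<open>G\<close> is first countable.
\<close>

lemma fan_exists:
  assumes sep: "separable_space T" and nm: "\<not> metrizable_space T"
  shows "\<exists>t. fan t"
proof (cases "\<forall>n. \<one> \<in> outer_limits n")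
  case True
  then show ?thesis by (intro fan_from_outer_limits[of "\<lambda>_. \<one>"]) (auto simp: topspace_eq)
next
  case False
  then obtain n where n: "\<one> \<notin> outer_limits n" by blast
  show ?thesis
  proof (cases "\<forall>j. \<one> \<in> T closure_of (outer_limits j \<inter> M n)")
    case True
    \<comment> \<open>If each piece failed for some index \<open>f i\<close>, the largest of these
      indices would fail for all pieces of \<open>M n\<close> at once, as
      \<open>outer_limits\<close> decreases. Within one piece a diagonal sequence exists.\<close>
    have "\<exists>i. \<forall>j. \<one> \<in> T closure_of (outer_limits j \<inter> K i)"
    proof (rule ccontr)
      assume "\<not> ?thesis"
      then obtain f where f: "\<And>i. \<one> \<notin> T closure_of (outer_limits (f i) \<inter> K i)" by metis
      define J where "J = Max (f ` {..n})"
      have "outer_limits J \<inter> M n = (\<Union>i\<in>{..n}. outer_limits J \<inter> K i)" unfolding M_def by auto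
      then have "\<one> \<in> T closure_of (\<Union>i\<in>{..n}. outer_limits J \<inter> K i)" using True by metis
      then obtain i where i: "i \<le> n" "\<one> \<in> T closure_of (outer_limits J \<inter> K i)"
        using in_closure_of_finite_Union[of "{..n}" \<one> T "\<lambda>i. outer_limits J \<inter> K i"] by auto
      have "f i \<le> J" unfolding J_def using i by simp
      then have "outer_limits J \<inter> K i \<subseteq> outer_limits (f i) \<inter> K i" using outer_limits_antimono by blast
      then show False using f i closure_of_mono by blast
    qed
    then obtain i where i: "\<And>j. \<one> \<in> T closure_of (outer_limits j \<inter> K i)" by blast
    obtain x :: "nat \<Rightarrow> 'a" where "\<And>j. x j \<in> outer_limits j \<inter> K i" "limitin T x \<one> sequentially"
      by (rule metrizable_subspace_diagonal_sequence[OF metrizable_K closed_K, of "\<lambda>j. outer_limits j \<inter> K i" i \<one>])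
        (use i in auto)
    then show ?thesis by (intro fan_from_outer_limits[of x]) auto
  next
    case False
    then obtain j0 where j0: "\<one> \<notin> T closure_of (outer_limits j0 \<inter> M n)" by blast
    define j where "j = max j0 n"
    have "outer_limits j \<inter> M n \<subseteq> outer_limits j0 \<inter> M n"
      unfolding j_def using outer_limits_antimono[of j0 "max j0 n"] by auto
    then have j: "\<one> \<notin> T closure_of (outer_limits j \<inter> M n)" using j0 closure_of_mono by blast
    have out: "\<one> \<notin> T closure_of (M l - M n)" for l using n unfolding outer_limits_def by blast
    have "\<one> \<in> M n"
    proof -
      have "\<one> \<in> (\<Union>n. K n)" unfolding cover_K by simp
      then obtain l where "\<one> \<in> K l" by blast
      then have "\<one> \<in> M l" using K_subset_M by blast
      moreover have "M l - M n \<subseteq> T closure_of (M l - M n)"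
        using closed_M[of l] closedin_subset closure_of_subset by (metis Diff_subset subset_trans)
      ultimately show ?thesis using out by blast
    qed
    define W where "W = M n - T closure_of (outer_limits j \<inter> M n) - T closure_of (M j - M n)"
    have Mc: "M n \<subseteq> topspace T" using closed_M closedin_subset by blast
    have "openin T W"
    proof (rule openin_K)
      show "W \<subseteq> carrier G" using Mc unfolding W_def topspace_eq by blast
      fix l
      have "\<exists>V. openin (subtopology T (K l)) V \<and> x \<in> V \<and> V \<subseteq> W \<inter> K l" if x: "x \<in> W \<inter> K l" for x
      proof -
        \<comment> \<open>The last closure may be removed because \<open>x\<close> is not in
          \<open>outer_limits j\<close>. A point of \<open>V \<inter> K l\<close> is then forced
          from \<open>M l\<close> into \<open>M j\<close>, and from there into \<open>M n\<close>,
          hence into \<open>W\<close>.\<close>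
        define V where "V = topspace T - T closure_of (outer_limits j \<inter> M n) - T closure_of (M j - M n)
            - T closure_of (M l - M j)"
        have "outer_limits j \<inter> M n \<subseteq> T closure_of (outer_limits j \<inter> M n)"
          using Mc by (intro closure_of_subset) auto
        then have "x \<notin> outer_limits j" using x unfolding W_def by blast
        then have "x \<in> V" using x Mc unfolding V_def W_def outer_limits_def by blast
        have "openin T V" unfolding V_def by (intro openin_diff closedin_closure_of openin_topspace)
        then have "openin (subtopology T (K l)) (V \<inter> K l)" by (auto simp: openin_subtopology)
        moreover have "V \<inter> K l \<subseteq> W \<inter> K l"
        proof
          fix y assume y: "y \<in> V \<inter> K l"
          have sub: "M a - M b \<subseteq> T closure_of (M a - M b)" for a b
            using closed_M[of a] closedin_subset closure_of_subset by (metis Diff_subset subset_trans)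
          have "y \<in> M l" using y K_subset_M by blast
          then have "y \<in> M j" using y sub[of l j] unfolding V_def by blast
          then have "y \<in> M n" using y sub[of j n] unfolding V_def by blast
          then show "y \<in> W \<inter> K l" using y unfolding V_def W_def by blast
        qed
        ultimately show ?thesis using \<open>x \<in> V\<close> x by blast
      qed
      then show "openin (subtopology T (K l)) (W \<inter> K l)" using openin_subopen by blast
    qed
    moreover have "\<one> \<in> W" using \<open>\<one> \<in> M n\<close> j out unfolding W_def by blast
    moreover have "W \<subseteq> M n" unfolding W_def by blast
    ultimately have "metrizable_space T"
      by (rule countable_base_of_open_subset_M) (rule separable_first_countable_imp_metrizable_space[OF sep])
    then show ?thesis using nm by blast
  qed
qed

end

lemma compact_metrizable_imp_second_countable:
  assumes "compact_space X" "metrizable_space X"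
  shows "second_countable X"
proof -
  obtain M d where "Metric_space M d" and X: "X = Metric_space.mtopology M d"
    using assms unfolding metrizable_space_def by blast
  then interpret Metric_space M d by simp
  have "mtotally_bounded M"
    using assms(1) unfolding X compact_space_def by (intro compactin_imp_mtotally_bounded) simp
  then have "\<exists>F. finite F \<and> F \<subseteq> M \<and> M \<subseteq> (\<Union>x\<in>F. mball x (1 / Suc k))" for k
    unfolding mtotally_bounded_def by simp
  then obtain F where F: "\<And>k. finite (F k)" "\<And>k. M \<subseteq> (\<Union>x\<in>F k. mball x (1 / Suc k))"
    by metis
  show ?thesis
    unfolding second_countable_def
  proof (intro exI conjI ballI allI impI)
    let ?B = "\<Union>k. (\<lambda>x. mball x (1 / Suc k)) ` F k"
    show "countable ?B" using F(1) by (auto intro: countable_finite)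
    show "openin X V" if "V \<in> ?B" for V using that unfolding X by auto
    fix U x assume U: "openin X U \<and> x \<in> U"
    then obtain r where r: "r > 0" "mball x r \<subseteq> U" unfolding X openin_mtopology by blast
    obtain k where k: "1 / Suc k < r / 2" using nat_approx_posE[of "r / 2"] r by auto
    have "x \<in> M" using U openin_subset unfolding X by fastforce
    then obtain z where z: "z \<in> F k" "x \<in> mball z (1 / Suc k)" using F(2)[of k] by blast
    have "mball z (1 / Suc k) \<subseteq> mball x r"
    proof
      fix y assume y: "y \<in> mball z (1 / Suc k)"
      then have "d x y \<le> d z x + d z y" using z triangle[of x z y] commute[of x z] by auto
      then show "y \<in> mball x r" using y z k by auto
    qed
    then show "\<exists>V\<in>?B. x \<in> V \<and> V \<subseteq> U" using z r by blast
  qed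
qed

section \<open>Local compactness of the metrizable pieces\<close>

context M_omega_t1_group begin

lemma compactin_insert_limit:
  assumes "limitin T s x sequentially" "range s \<subseteq> carrier G"
  shows "compactin T (insert x (range s))"
  using assms by (intro compactin_sequence_with_limit) (auto simp: topspace_eq)

text \<open>A product in \<open>D\<close> has its first factor in \<open>D\<close> times the inverse
  of the compact set formed by \<open>t n\<close> and its limit. That set is compact and so contains
  finitely many values of \<open>f\<close>.\<close>

lemma fan_products_finite:
  assumes t: "fan t" and inj: "inj f" and f: "range f \<subseteq> carrier G"
    and disc: "\<And>D. compactin T D \<Longrightarrow> finite (range f \<inter> D)"
    and D: "compactin T D"
  shows "finite {m. f m \<otimes> t n m \<in> D}"
proof -
  have tn: "limitin T (t n) \<one> sequentially" "range (t n) \<subseteq> carrier G" using t unfolding fan_def by auto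
  have Dc: "D \<subseteq> carrier G" using D compactin_subset_topspace topspace_eq by blast
  let ?E = "D <#> set_inv (insert \<one> (range (t n)))"
  have E: "compactin T ?E"
    by (intro compactin_set_mult compactin_set_inv D compactin_insert_limit tn)
  have "f m \<in> range f \<inter> ?E" if "f m \<otimes> t n m \<in> D" for m
  proof -
    have "(f m \<otimes> t n m) \<otimes> inv (t n m) \<in> ?E" using that by (intro set_multI set_invI) auto
    moreover have "(f m \<otimes> t n m) \<otimes> inv (t n m) = f m" using f tn(2) by (simp add: m_assoc image_subset_iff)
    ultimately show ?thesis by simp
  qed
  then have "f ` {m. f m \<otimes> t n m \<in> D} \<subseteq> range f \<inter> ?E" by blast
  then have "finite (f ` {m. f m \<otimes> t n m \<in> D})" using disc[OF E] finite_subset by blast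
  then show ?thesis using inj finite_imageD inj_on_subset by blast
qed

text \<open>No closed ball around \<open>x0\<close> in the piece is compact, so by
  Bolzano-Weierstrass each contains an infinite subset without accumulation point in the ball. The
  radii \<open>1 / Suc n\<close> make these subsets shrink to \<open>x0\<close>.\<close>

lemma noncompact_ball_sequences:
  assumes x0: "x0 \<in> K i"
    and nlc: "\<And>U C. openin (subtopology T (K i)) U \<Longrightarrow> compactin (subtopology T (K i)) C \<Longrightarrow> x0 \<in> U \<Longrightarrow> \<not> U \<subseteq> C"
  obtains x :: "nat \<Rightarrow> nat \<Rightarrow> 'a" where "\<And>n. range (x n) \<subseteq> K i" "\<And>n. inj (x n)"
    "\<And>n D. compactin T D \<Longrightarrow> finite (range (x n) \<inter> D)"
    "\<And>U. openin T U \<Longrightarrow> x0 \<in> U \<Longrightarrow> \<exists>N. \<forall>n\<ge>N. range (x n) \<subseteq> U"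
proof -
  let ?X = "subtopology T (K i)"
  have tX: "topspace ?X = K i" using closed_K closedin_subset by auto
  obtain M d where "Metric_space M d" and X: "?X = Metric_space.mtopology M d"
    using metrizable_K[of i] unfolding metrizable_space_def by blast
  then interpret Metric_space M d by simp
  have M: "M = K i" using tX unfolding X by simp
  then have x0M: "x0 \<in> M" using x0 by simp
  define C where "C = (\<lambda>n. mcball x0 (1 / Suc n))"
  have "\<exists>S. infinite S \<and> S \<subseteq> C n \<and> C n \<inter> ?X derived_set_of S = {}" for n
  proof -
    have "openin ?X (mball x0 (1 / Suc n))" "x0 \<in> mball x0 (1 / Suc n)" "mball x0 (1 / Suc n) \<subseteq> C n"
      unfolding X C_def using x0M mball_subset_mcball by auto
    then have "\<not> compactin ?X (C n)" using nlc by blast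
    moreover have "C n \<subseteq> M" unfolding C_def by (simp add: mcball_subset_mspace)
    ultimately show ?thesis unfolding X compactin_eq_Bolzano_Weierstrass by blast
  qed
  then obtain S where S: "\<And>n. infinite (S n)" "\<And>n. S n \<subseteq> C n" "\<And>n. C n \<inter> ?X derived_set_of (S n) = {}"
    by metis
  have "\<exists>f :: nat \<Rightarrow> 'a. inj f \<and> range f \<subseteq> S n" for n
    using S(1) infinite_countable_subset by blast
  then obtain x :: "nat \<Rightarrow> nat \<Rightarrow> 'a" where x: "\<And>n. inj (x n)" "\<And>n. range (x n) \<subseteq> S n" by metis
  show thesis
  proof
    show "range (x n) \<subseteq> K i" for n
      using x(2)[of n] S(2)[of n] M mcball_subset_mspace unfolding C_def by blast
    show "inj (x n)" for n by (rule x)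
    show "finite (range (x n) \<inter> D)" if D: "compactin T D" for n D
    proof (rule ccontr)
      assume inf: "infinite (range (x n) \<inter> D)"
      have "closedin ?X (C n)" unfolding X C_def by simp
      then have "closedin T (C n)" using closed_K closedin_trans_full by blast
      then have "compactin T (C n \<inter> D)" using D by (metis closed_Int_compactin)
      moreover have "C n \<subseteq> K i" using M mcball_subset_mspace unfolding C_def by blast
      ultimately have "compactin ?X (C n \<inter> D)" by (auto simp: compactin_subtopology)
      moreover have "range (x n) \<inter> D \<subseteq> C n \<inter> D" using x S by blast
      ultimately have "(C n \<inter> D) \<inter> ?X derived_set_of (range (x n) \<inter> D) \<noteq> {}"
        using compactin_imp_Bolzano_Weierstrass inf by blast
      moreover have "?X derived_set_of (range (x n) \<inter> D) \<subseteq> ?X derived_set_of (S n)"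
        using x by (intro derived_set_of_mono) blast
      ultimately show False using S(3)[of n] by blast
    qed
    show "\<exists>N. \<forall>n\<ge>N. range (x n) \<subseteq> U" if U: "openin T U" "x0 \<in> U" for U
    proof -
      have "openin ?X (U \<inter> K i)" using U by (auto simp: openin_subtopology)
      then obtain r where r: "r > 0" "mball x0 r \<subseteq> U \<inter> K i"
        using U x0 unfolding X openin_mtopology by blast
      obtain N where N: "1 / Suc N < r" using nat_approx_posE r by blast
      have "range (x n) \<subseteq> U" if "n \<ge> N" for n
      proof -
        have "1 / real (Suc n) \<le> 1 / real (Suc N)" using that by (intro divide_left_mono) auto
        then have "C n \<subseteq> mball x0 r" unfolding C_def using N by (intro mcball_subset_mball_concentric) linarith
        then show ?thesis using x(2)[of n] S(2)[of n] r by blast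
      qed
      then show ?thesis by blast
    qed
  qed
qed

text \<open>If \<open>K i\<close> failed to be locally compact at \<open>x0\<close>, then multiplying closed discrete sequences of
  \<open>K i\<close> that shrink to \<open>x0\<close> with the sequences of the fan would produce a set that is closed
  although it accumulates at \<open>x0\<close>.\<close>

lemma fan_imp_locally_compact:
  assumes t: "fan t"
  shows "locally_compact_space (subtopology T (K i))"
proof (rule ccontr)
  let ?X = "subtopology T (K i)"
  have tX: "topspace ?X = K i" using closed_K closedin_subset by auto
  assume "\<not> locally_compact_space ?X"
  then obtain x0 where x0: "x0 \<in> K i"
    and nlc: "\<And>U C. openin ?X U \<Longrightarrow> compactin ?X C \<Longrightarrow> x0 \<in> U \<Longrightarrow> \<not> U \<subseteq> C"
    unfolding locally_compact_space_def tX by blast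
  obtain x :: "nat \<Rightarrow> nat \<Rightarrow> 'a" where x: "\<And>n. range (x n) \<subseteq> K i" "\<And>n. inj (x n)"
    "\<And>n D. compactin T D \<Longrightarrow> finite (range (x n) \<inter> D)"
    and xU: "\<And>U. openin T U \<Longrightarrow> x0 \<in> U \<Longrightarrow> \<exists>N. \<forall>n\<ge>N. range (x n) \<subseteq> U"
    using noncompact_ball_sequences[OF x0 nlc] by blast
  have Kc: "K i \<subseteq> carrier G" for i using closed_K closedin_subset topspace_eq by blast
  have xc: "x n m \<in> carrier G" for n m using x(1)[of n] Kc by blast
  have tc: "t n m \<in> carrier G" for n m using t unfolding fan_def by blast
  have fin: "finite {m. x n m \<otimes> t n m \<in> D}" if "compactin T D" for n D
    using xc x by (intro fan_products_finite[OF t _ _ _ that]) auto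
  \<comment> \<open>Otherwise first factors with unbounded n form a sequence converging to
    \<open>x0\<close>; the inverses of this sequence and its limit, multiplied by \<open>D\<close>,
    form a compact set that meets infinitely many sequences of the fan.\<close>
  have bounded: "\<exists>N. \<forall>n m. x n m \<otimes> t n m \<in> D \<longrightarrow> n < N" if D: "compactin T D" for D
  proof (rule ccontr)
    assume "\<not> ?thesis"
    then have "\<exists>n m. N \<le> n \<and> x n m \<otimes> t n m \<in> D" for N by (metis not_less)
    then obtain n m where nm: "\<And>k. k \<le> n k" "\<And>k. x (n k) (m k) \<otimes> t (n k) (m k) \<in> D" by metis
    let ?s = "\<lambda>k. x (n k) (m k)"
    have "limitin T ?s x0 sequentially"
      unfolding limitin_def eventually_sequentially
    proof (intro conjI allI impI)
      show "x0 \<in> topspace T" using x0 Kc topspace_eq by blast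
      fix U assume "openin T U \<and> x0 \<in> U"
      then obtain N where N: "\<forall>n\<ge>N. range (x n) \<subseteq> U" using xU by blast
      then have "?s k \<in> U" if "k \<ge> N" for k using nm(1)[of k] that by (meson dual_order.trans rangeI subsetD)
      then show "\<exists>N. \<forall>k\<ge>N. ?s k \<in> U" by blast
    qed
    then have "compactin T (insert x0 (range ?s))" using xc by (intro compactin_insert_limit) auto
    then have E: "compactin T (set_inv (insert x0 (range ?s)) <#> D)"
      using D compactin_set_mult compactin_set_inv by blast
    obtain N where N: "\<forall>n\<ge>N. \<forall>m. t n m \<notin> set_inv (insert x0 (range ?s)) <#> D"
      using t E unfolding fan_def by blast
    have "inv (?s N) \<otimes> (?s N \<otimes> t (n N) (m N)) \<in> set_inv (insert x0 (range ?s)) <#> D"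
      using nm(2) by (intro set_multI set_invI) auto
    moreover have "inv (?s N) \<otimes> (?s N \<otimes> t (n N) (m N)) = t (n N) (m N)"
      using xc tc by (simp add: m_assoc[symmetric])
    ultimately show False using N nm(1)[of N] by simp
  qed
  \<comment> \<open>Excluding \<open>x0\<close> makes the accumulation of \<open>A\<close> at
    \<open>x0\<close> contradict its closedness. By \<open>fin\<close> for the compact set
    \<open>{x0}\<close>, each n loses only finitely many m, so the accumulation persists.\<close>
  define A where "A = {x n m \<otimes> t n m | n m. x n m \<otimes> t n m \<noteq> x0}"
  have Ac: "A \<subseteq> carrier G" unfolding A_def using xc tc by blast
  have finA: "finite (A \<inter> D)" if D: "compactin T D" for D
  proof -
    obtain N where N: "\<And>n m. x n m \<otimes> t n m \<in> D \<Longrightarrow> n < N" using bounded[OF D] by blast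
    have "A \<inter> D \<subseteq> (\<Union>n\<in>{..<N}. (\<lambda>m. x n m \<otimes> t n m) ` {m. x n m \<otimes> t n m \<in> D})"
      unfolding A_def using N by blast
    moreover have "finite (\<Union>n\<in>{..<N}. (\<lambda>m. x n m \<otimes> t n m) ` {m. x n m \<otimes> t n m \<in> D})"
      using fin[OF D] by blast
    ultimately show ?thesis by (rule finite_subset)
  qed
  have "closedin T A"
  proof (rule closedin_K[OF Ac])
    fix j
    have "y \<in> A \<inter> K j" if y: "y \<in> T closure_of (A \<inter> K j)" for y
    proof -
      obtain a :: "nat \<Rightarrow> 'a" where a: "\<And>n. a n \<in> A \<inter> K j" "limitin T a y sequentially"
        by (rule metrizable_subspace_diagonal_sequence[OF metrizable_K closed_K, of "\<lambda>_. A \<inter> K j" j y]) (use y in auto)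
      have "compactin T (insert y (range a))" using a Ac by (intro compactin_insert_limit) auto
      from finA[OF this] have "finite (range a)" by (rule rev_finite_subset) (use a in auto)
      moreover have "range a \<subseteq> carrier G" using a Ac by blast
      ultimately have "closedin T (range a)" by (rule closedin_finite)
      then have "y \<in> range a" by (rule limitin_closedin[OF a(2)]) auto
      then show ?thesis using a by blast
    qed
    then have "T closure_of (A \<inter> K j) \<subseteq> A \<inter> K j" by blast
    then show "closedin T (A \<inter> K j)" using Ac by (metis closure_of_subset_eq le_infI1 topspace_eq)
  qed
  have x0c: "x0 \<in> carrier G" using x0 Kc by blast
  have "x0 \<in> T closure_of A"
    unfolding in_closure_of
  proof (intro conjI allI impI)
    show "x0 \<in> topspace T" using x0c topspace_eq by simp
    fix U assume U: "x0 \<in> U \<and> openin T U"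
    then have "x0 \<otimes> \<one> \<in> U" using x0c by simp
    then obtain P Q where PQ: "openin T P" "openin T Q" "x0 \<in> P" "\<one> \<in> Q"
      "\<And>p q. p \<in> P \<Longrightarrow> q \<in> Q \<Longrightarrow> p \<otimes> q \<in> U"
      using openin_multD[of U x0 \<one>] U x0c by (metis one_closed)
    obtain n where n: "range (x n) \<subseteq> P" using xU[OF PQ(1,3)] by blast
    have "limitin T (t n) \<one> sequentially" using t unfolding fan_def by blast
    then obtain m0 where m0: "\<And>m. m \<ge> m0 \<Longrightarrow> t n m \<in> Q"
      using PQ unfolding limitin_def eventually_sequentially by blast
    have "finite {m. x n m \<otimes> t n m \<in> {x0}}" using x0c by (intro fin) (simp add: topspace_eq)
    then have "infinite ({m0..} - {m. x n m \<otimes> t n m \<in> {x0}})" by (simp add: infinite_Ici)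
    then obtain m where "m \<ge> m0" "x n m \<otimes> t n m \<noteq> x0"
      by (metis (no_types, lifting) Diff_iff atLeast_iff finite.emptyI equals0I mem_Collect_eq singletonI)
    then have "x n m \<otimes> t n m \<in> A" "x n m \<otimes> t n m \<in> U"
      using PQ(5) n m0 unfolding A_def by blast+
    then show "\<exists>y. y \<in> A \<and> y \<in> U" by blast
  qed
  then have "x0 \<in> A" using \<open>closedin T A\<close> by (simp add: closure_of_closedin)
  then show False unfolding A_def by blast
qed

end

section \<open>Compact pieces\<close>

locale k_omega_t1_group = M_omega_t1_group +
  assumes compact_K: "compactin T (K n)"

context M_omega_t1_group begin

text \<open>Starting from a countable dense set, countably many compact sets are generated by
  products, inverses and compact neighbourhoods. Their union is an open subgroup, and an open
  subgroup that is dense is the whole group.\<close>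

lemma locally_compact_imp_k_omega:
  assumes sep: "separable_space T"
    and lc: "\<And>i. locally_compact_space (subtopology T (K i))"
  obtains C where "k_omega_t1_group G T C"
proof -
  have "\<exists>C. compactin T S \<longrightarrow> compactin T C \<and> C \<subseteq> K i \<and>
      (\<exists>U. openin (subtopology T (K i)) U \<and> S \<inter> K i \<subseteq> U \<and> U \<subseteq> C)" for S i
  proof (cases "compactin T S")
    case True
    then have "compactin T (S \<inter> K i)" using closed_K compact_Int_closedin by blast
    then have "compactin (subtopology T (K i)) (S \<inter> K i)" by (simp add: compactin_subtopology)
    then obtain U C where "openin (subtopology T (K i)) U" "compactin (subtopology T (K i)) C"
        "S \<inter> K i \<subseteq> U" "U \<subseteq> C"
      using lc[of i] locally_compact_space_compact_closed_compact[of "subtopology T (K i)"] Hausdorff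
        Hausdorff_space_subtopology by meson
    then show ?thesis by (auto simp: compactin_subtopology)
  qed auto
  \<comment> \<open>For compact \<open>S\<close>, \<open>nb S i\<close> is a compact neighbourhood
    of \<open>S \<inter> K i\<close> relative to \<open>K i\<close>.\<close>
  then obtain nb where nb: "\<And>S i. compactin T S \<Longrightarrow> compactin T (nb S i) \<and> nb S i \<subseteq> K i \<and>
      (\<exists>U. openin (subtopology T (K i)) U \<and> S \<inter> K i \<subseteq> U \<and> U \<subseteq> nb S i)" by metis
  obtain D where D: "countable D" "D \<subseteq> carrier G" "T closure_of D = carrier G"
    using sep unfolding separable_space_def topspace_eq by blast
  \<comment> \<open>the union of the compact sets in \<open>\<Union>k. F k\<close> is closed under the group operations and open\<close>
  define F where "F = rec_nat ((\<lambda>d. {d}) ` D) (\<lambda>_ \<A>. \<A> \<union> (\<lambda>(A, B). A <#> B) ` (\<A> \<times> \<A>) \<union> (\<lambda>A. set_inv A) ` \<A> \<union>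
      (\<lambda>(A, i). nb A i) ` (\<A> \<times> UNIV))"
  have F0: "F 0 = (\<lambda>d. {d}) ` D" unfolding F_def by simp
  have FS: "F (Suc k) = F k \<union> (\<lambda>(A, B). A <#> B) ` (F k \<times> F k) \<union> (\<lambda>A. set_inv A) ` F k \<union>
      (\<lambda>(A, i). nb A i) ` (F k \<times> UNIV)" for k unfolding F_def by simp
  have F_mono: "F k \<subseteq> F l" if "k \<le> l" for k l
    using that by (rule lift_Suc_mono_le[of F, rotated]) (auto simp: FS)
  have Fcount: "countable (F k)" for k by (induction k) (use D in \<open>auto simp: F0 FS\<close>)
  have Fcpt: "compactin T A" if "A \<in> F k" for A k
    using that
  proof (induction k arbitrary: A)
    case 0
    then show ?case using D by (auto simp: F0 topspace_eq)
  next
    case (Suc k)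
    then show ?case using compactin_set_mult compactin_set_inv nb unfolding FS by auto
  qed
  define \<F> where "\<F> = (\<Union>k. F k)"
  have mult: "A <#> B \<in> \<F>" if AB: "A \<in> \<F>" "B \<in> \<F>" for A B
  proof -
    obtain k l where "A \<in> F k" "B \<in> F l" using AB \<F>_def by blast
    then have "A \<in> F (max k l)" "B \<in> F (max k l)"
      using F_mono[of k "max k l"] F_mono[of l "max k l"] by auto
    then have "A <#> B \<in> F (Suc (max k l))" unfolding FS by auto
    then show ?thesis unfolding \<F>_def by blast
  qed
  have inv: "set_inv A \<in> \<F>" and nbF: "nb A i \<in> \<F>" if A: "A \<in> \<F>" for A i
  proof -
    obtain k where "A \<in> F k" using A \<F>_def by blast
    then have "set_inv A \<in> F (Suc k)" "nb A i \<in> F (Suc k)" unfolding FS by auto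
    then show "set_inv A \<in> \<F>" "nb A i \<in> \<F>" unfolding \<F>_def by blast+
  qed
  have cpt: "compactin T A" if "A \<in> \<F>" for A using that Fcpt \<F>_def by blast
  have \<F>count: "countable \<F>" unfolding \<F>_def using Fcount by blast
  define H where "H = \<Union>\<F>"
  have Hc: "H \<subseteq> carrier G"
    unfolding H_def using cpt compactin_subset_topspace topspace_eq by blast
  have Hop: "openin T H"
  proof (rule openin_K[OF Hc])
    fix i
    have "\<exists>U. openin (subtopology T (K i)) U \<and> x \<in> U \<and> U \<subseteq> H \<inter> K i" if x: "x \<in> H \<inter> K i" for x
    proof -
      obtain A where A: "A \<in> \<F>" "x \<in> A" using x H_def by blast
      then obtain U where U: "openin (subtopology T (K i)) U" "A \<inter> K i \<subseteq> U" "U \<subseteq> nb A i"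
        using nb[OF cpt[OF A(1)], of i] by blast
      moreover have "nb A i \<subseteq> H" using nbF[OF A(1)] H_def by blast
      moreover have "nb A i \<subseteq> K i" using nb[OF cpt[OF A(1)], of i] by blast
      ultimately show ?thesis using A x by blast
    qed
    then show "openin (subtopology T (K i)) (H \<inter> K i)" using openin_subopen by blast
  qed
  have DH: "D \<subseteq> H"
  proof
    fix d assume "d \<in> D"
    then have "{d} \<in> \<F>" using F0 \<F>_def by blast
    then show "d \<in> H" unfolding H_def by blast
  qed
  have Hall: "H = carrier G"
  proof
    show "carrier G \<subseteq> H"
    proof
      fix x assume x: "x \<in> carrier G"
      have meets: "\<exists>d\<in>D. d \<in> W" if "openin T W" "z \<in> W" for W z
      proof -
        have "z \<in> T closure_of D" using that D(3) openin_subset[of T W] topspace_eq by blast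
        then show ?thesis using that unfolding in_closure_of by blast
      qed
      obtain h where h: "h \<in> H" using meets[OF openin_topspace, of \<one>] DH topspace_eq by auto
      have "x \<otimes> h \<in> x <# H" using h unfolding l_coset_def by blast
      then obtain d where d: "d \<in> D" "d \<in> x <# H" using meets openin_lcoset[OF Hop x] by blast
      then obtain h' where h': "h' \<in> H" "d = x \<otimes> h'" unfolding l_coset_def by blast
      then have xd: "x = d \<otimes> inv h'" using x Hc D d by (simp add: inv_solve_right subset_iff)
      obtain A B where "A \<in> \<F>" "d \<in> A" "B \<in> \<F>" "h' \<in> B" using d DH h' H_def by blast
      then have "x \<in> A <#> set_inv B" "A <#> set_inv B \<in> \<F>"
        unfolding xd using mult inv by (auto intro: set_multI set_invI)
      then show "x \<in> H" unfolding H_def by blast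
    qed
  qed (rule Hc)
  \<comment> \<open>Only the sets \<open>nb A i\<close> become new pieces: they lie in
    \<open>K i\<close> and are therefore metrizable, which is not known for products. They still
    determine the topology, since each point of \<open>K i\<close> has one of them as a
    neighbourhood in \<open>K i\<close>.\<close>
  define \<C> where "\<C> = (\<lambda>(A, i). nb A i) ` (\<F> \<times> (UNIV :: nat set))"
  have "countable \<C>" unfolding \<C>_def using \<F>count by blast
  have \<C>D: "compactin T C" "metrizable_space (subtopology T C)" if C: "C \<in> \<C>" for C
  proof -
    obtain A i where A: "A \<in> \<F>" "C = nb A i" using C \<C>_def by auto
    then have "C \<subseteq> K i" and "compactin T C" using nb[OF cpt[OF A(1)], of i] by simp_all
    then show "compactin T C" "metrizable_space (subtopology T C)"
      using metrizable_space_subtopology[OF metrizable_K[of i], of C]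
      by (auto simp: subtopology_subtopology inf_absorb2)
  qed
  have cover: "\<exists>A\<in>\<F>. x \<in> A" if "x \<in> carrier G" for x using that Hall H_def by blast
  have \<C>open: "openin T U" if Uc: "U \<subseteq> carrier G" and U: "\<And>C. C \<in> \<C> \<Longrightarrow> openin (subtopology T C) (U \<inter> C)" for U
  proof (rule openin_K[OF Uc])
    fix i
    have "\<exists>V. openin (subtopology T (K i)) V \<and> x \<in> V \<and> V \<subseteq> U \<inter> K i" if x: "x \<in> U \<inter> K i" for x
    proof -
      obtain A where A: "A \<in> \<F>" "x \<in> A" using cover x Uc by blast
      obtain V where V: "openin (subtopology T (K i)) V" "A \<inter> K i \<subseteq> V" "V \<subseteq> nb A i"
        using nb[OF cpt[OF A(1)], of i] by blast
      have "nb A i \<in> \<C>" unfolding \<C>_def using A by auto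
      then obtain W where W: "openin T W" "U \<inter> nb A i = W \<inter> nb A i"
        using U[of "nb A i"] unfolding openin_subtopology by auto
      have "openin (subtopology T (K i)) (W \<inter> K i)" using W(1) by (auto simp: openin_subtopology)
      then have "openin (subtopology T (K i)) (V \<inter> (W \<inter> K i))" by (rule openin_Int[OF V(1)])
      moreover have "V \<subseteq> K i" using openin_subset[OF V(1)] by simp
      ultimately show ?thesis using V W A x by blast
    qed
    then show "openin (subtopology T (K i)) (U \<inter> K i)" using openin_subopen by blast
  qed
  have \<C>cover: "\<Union>\<C> = carrier G"
  proof
    show "\<Union>\<C> \<subseteq> carrier G" using \<C>D compactin_subset_topspace topspace_eq by blast
    show "carrier G \<subseteq> \<Union>\<C>"
    proof
      fix x assume x: "x \<in> carrier G"
      then have "x \<in> (\<Union>n. K n)" unfolding cover_K .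
      then obtain i where i: "x \<in> K i" by blast
      obtain A where A: "A \<in> \<F>" "x \<in> A" using cover x by blast
      then have "x \<in> nb A i" using nb[OF cpt[OF A(1)], of i] i by blast
      moreover have "nb A i \<in> \<C>" unfolding \<C>_def using A by auto
      ultimately show "x \<in> \<Union>\<C>" by blast
    qed
  qed
  have "\<C> \<noteq> {}" using \<C>cover one_closed by blast
  then have range: "range (from_nat_into \<C>) = \<C>" using \<open>countable \<C>\<close> by (rule range_from_nat_into)
  have in\<C>: "from_nat_into \<C> n \<in> \<C>" for n using range by blast
  have "k_omega_t1_group G T (from_nat_into \<C>)"
  proof unfold_locales
    show "compactin T (from_nat_into \<C> n)" for n using \<C>D in\<C> by blast
    then show "closedin T (from_nat_into \<C> n)" for n using Hausdorff compactin_imp_closedin by blast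
    show "metrizable_space (subtopology T (from_nat_into \<C> n))" for n using \<C>D in\<C> by blast
    show "(\<Union>n. from_nat_into \<C> n) = carrier G" using range \<C>cover by simp
    show "openin T U" if "U \<subseteq> carrier G"
      and U: "\<And>n. openin (subtopology T (from_nat_into \<C> n)) (U \<inter> from_nat_into \<C> n)" for U
    proof (rule \<C>open[OF that(1)])
      fix C assume "C \<in> \<C>"
      then obtain n where "C = from_nat_into \<C> n" using range by blast
      then show "openin (subtopology T C) (U \<inter> C)" using U by simp
    qed
  qed
  then show thesis by (rule that)
qed

end

section \<open>Compact subsets of the group and the tower they form\<close>

context k_omega_t1_group begin

lemma second_countable_K: "second_countable (subtopology T (K n))"
  using compact_K metrizable_K by (intro compact_metrizable_imp_second_countable) (auto simp: compact_space_subtopology)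

text \<open>The bases of the pieces are pooled. Their members are open only in a piece, so the
  result is a network and not a base.\<close>

lemma countable_network:
  obtains \<N> where "countable \<N>" "\<And>U x. openin T U \<Longrightarrow> x \<in> U \<Longrightarrow> \<exists>N\<in>\<N>. x \<in> N \<and> N \<subseteq> U"
proof -
  have "\<exists>\<B>. countable \<B> \<and> (\<forall>U x. openin (subtopology T (K n)) U \<and> x \<in> U \<longrightarrow> (\<exists>V\<in>\<B>. x \<in> V \<and> V \<subseteq> U))" for n
    using second_countable_K[of n] unfolding second_countable_def by blast
  then obtain \<B> where \<B>: "\<And>n. countable (\<B> n)"
    "\<And>n U x. openin (subtopology T (K n)) U \<Longrightarrow> x \<in> U \<Longrightarrow> \<exists>V\<in>\<B> n. x \<in> V \<and> V \<subseteq> U" by metis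
  show thesis
  proof
    show "countable (\<Union>n. \<B> n)" using \<B>(1) by blast
    fix U x assume U: "openin T U" "x \<in> U"
    then have "x \<in> (\<Union>n. K n)" unfolding cover_K using openin_subset topspace_eq by blast
    then obtain n where "x \<in> K n" by blast
    moreover have "openin (subtopology T (K n)) (U \<inter> K n)" using U by (auto simp: openin_subtopology)
    ultimately obtain V where "V \<in> \<B> n" "x \<in> V" "V \<subseteq> U \<inter> K n" using \<B>(2)[of n "U \<inter> K n" x] U by blast
    then show "\<exists>N\<in>\<Union>n. \<B> n. x \<in> N \<and> N \<subseteq> U" by blast
  qed
qed

text \<open>The closure of a connected subset of \<open>D\<close> is compact and connected, hence at
  most one point, so points of \<open>D\<close> are separated by clopen sets. One clopen set for
  each separable pair of network members is enough, which gives countably many coordinates.\<close>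

lemma punctiform_compact_zero_dim:
  assumes punct: "punctiform T" and D: "compactin T D"
  shows "compact_zero_dim (subtopology T D)"
proof -
  let ?X = "subtopology T D"
  have cX: "compact_space ?X" using D by (simp add: compact_space_subtopology)
  have tX: "topspace ?X = D" using compactin_subset_topspace[OF D] by auto
  have HX: "Hausdorff_space ?X" using Hausdorff Hausdorff_space_subtopology by blast
  have Dcl: "closedin T D" using D Hausdorff compactin_imp_closedin by blast
  have sep: "\<exists>U. openin ?X U \<and> openin ?X (D - U) \<and> x \<in> U \<and> y \<in> D - U" if xy: "x \<in> D" "y \<in> D" "x \<noteq> y" for x y
  proof -
    have "separated_between ?X {x} {y}"
    proof (rule cut_wire_fence_theorem[OF cX HX])
      show "closedin ?X {x}" "closedin ?X {y}"
        using xy tX HX by (auto intro!: closedin_Hausdorff_singleton)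
      fix C assume "connectedin ?X C"
      then have C: "connectedin T C" "C \<subseteq> D" by (auto simp: connectedin_subtopology)
      then have cl: "T closure_of C \<subseteq> D" using Dcl closure_of_minimal by blast
      have "compactin T (T closure_of C)" using D cl closed_compactin closedin_closure_of by blast
      moreover have "connectedin T (T closure_of C)" using C connectedin_closure_of by blast
      moreover have "C \<subseteq> T closure_of C" by (intro closure_of_subset connectedin_subset_topspace C)
      ultimately show "disjnt C {x} \<or> disjnt C {y}"
        using punct xy(3) unfolding punctiform_def disjnt_iff by blast
    qed
    then obtain U where U: "closedin ?X U" "openin ?X U" "{x} \<subseteq> U" "{y} \<subseteq> topspace ?X - U"
      using separated_between[of ?X] by blast
    then show ?thesis using openin_diff[OF openin_topspace U(1)] unfolding tX by blast
  qed
  obtain \<N> where \<N>: "countable \<N>" "\<And>U x. openin T U \<Longrightarrow> x \<in> U \<Longrightarrow> \<exists>N\<in>\<N>. x \<in> N \<and> N \<subseteq> U"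
    using countable_network by blast
  define splits where "splits = (\<lambda>p U. openin ?X U \<and> openin ?X (D - U) \<and> fst p \<inter> D \<subseteq> U \<and> snd p \<inter> U = {})"
  \<comment> \<open>The empty set is a clopen default for pairs that cannot be split, so every
    coordinate stays continuous.\<close>
  define \<psi> where "\<psi> = (\<lambda>p. if \<exists>U. splits p U then SOME U. splits p U else {})"
  have \<psi>: "openin ?X (\<psi> p) \<and> openin ?X (D - \<psi> p)" for p
  proof (cases "\<exists>U. splits p U")
    case True
    then have "splits p (\<psi> p)" unfolding \<psi>_def using someI_ex[of "splits p"] by simp
    then show ?thesis unfolding splits_def by blast
  next
    case False
    then have "\<psi> p = {}" unfolding \<psi>_def by (rule if_not_P)
    then show ?thesis using openin_topspace[of ?X] unfolding tX by simp
  qed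
  define \<phi> where "\<phi> = (\<lambda>x k. x \<in> \<psi> (from_nat_into (\<N> \<times> \<N>) k))"
  have "continuous_map ?X discrete (\<lambda>x. x \<in> \<psi> p)" for p
    unfolding continuous_map_into_discrete
  proof
    fix y
    have "{x \<in> topspace ?X. (x \<in> \<psi> p) = y} = (if y then \<psi> p else D - \<psi> p)"
      using openin_subset[OF conjunct1[OF \<psi>[of p]]] unfolding tX by (cases y) auto
    then show "openin ?X {x \<in> topspace ?X. (x \<in> \<psi> p) = y}" using \<psi>[of p] by simp
  qed
  then have "continuous_map ?X cantor_cube \<phi>"
    unfolding continuous_map_into_cantor_cube \<phi>_def by blast
  moreover have "inj_on \<phi> (topspace ?X)"
    unfolding tX
  proof (rule inj_onI, rule ccontr)
    fix x y assume xy: "x \<in> D" "y \<in> D" "\<phi> x = \<phi> y" "x \<noteq> y"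
    then obtain U where U: "openin ?X U" "openin ?X (D - U)" "x \<in> U" "y \<in> D - U" using sep by metis
    obtain V where V: "openin T V" "U = V \<inter> D" using U(1) unfolding openin_subtopology by blast
    obtain V' where V': "openin T V'" "D - U = V' \<inter> D" using U(2) unfolding openin_subtopology by blast
    obtain N where N: "N \<in> \<N>" "x \<in> N" "N \<subseteq> V" using \<N>(2)[OF V(1), of x] U V by blast
    obtain N' where N': "N' \<in> \<N>" "y \<in> N'" "N' \<subseteq> V'" using \<N>(2)[OF V'(1), of y] U V' by blast
    have "splits (N, N') U" unfolding splits_def using U V V' N N' by auto
    then have "splits (N, N') (\<psi> (N, N'))" unfolding \<psi>_def using someI_ex[of "splits (N, N')"] by auto
    then have *: "x \<in> \<psi> (N, N')" "y \<notin> \<psi> (N, N')" unfolding splits_def using N N' xy by auto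
    have "countable (\<N> \<times> \<N>)" "(N, N') \<in> \<N> \<times> \<N>" using \<N> N N' by auto
    then obtain k where "from_nat_into (\<N> \<times> \<N>) k = (N, N')" by (metis from_nat_into_to_nat_on)
    then have "\<phi> x k" "\<not> \<phi> y k" using * unfolding \<phi>_def by auto
    then show False using xy(3) by simp
  qed
  ultimately show ?thesis unfolding compact_zero_dim_def using cX by blast
qed

text \<open>The condensation points of an uncountable compact piece, translated to the identity.\<close>

lemma perfect_compact_exists:
  assumes unc: "uncountable (carrier G)"
  obtains P where "compactin T P" "\<one> \<in> P" "\<And>x U. x \<in> P \<Longrightarrow> openin T U \<Longrightarrow> x \<in> U \<Longrightarrow> \<exists>y\<in>P. y \<in> U \<and> y \<noteq> x"
proof -
  have "\<exists>n. uncountable (K n)" using unc cover_K by (metis countable_UN countableI_type)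
  then obtain n where n: "uncountable (K n)" by blast
  have Kc: "K n \<subseteq> carrier G" using closed_K closedin_subset topspace_eq by blast
  obtain \<B> where \<B>: "countable \<B>"
    "\<And>U x. openin (subtopology T (K n)) U \<Longrightarrow> x \<in> U \<Longrightarrow> \<exists>V\<in>\<B>. x \<in> V \<and> V \<subseteq> U"
    using second_countable_K[of n] unfolding second_countable_def by metis
  define Q where "Q = {x \<in> K n. \<forall>U. openin T U \<longrightarrow> x \<in> U \<longrightarrow> uncountable (U \<inter> K n)}"
  \<comment> \<open>The Cantor-Bendixson argument: a point that is no condensation point has a
    countable basic neighbourhood, and there are only countably many basic sets.\<close>
  have "K n - Q \<subseteq> (\<Union>B\<in>{B \<in> \<B>. countable B}. B)"
  proof
    fix x assume x: "x \<in> K n - Q"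
    then obtain U where U: "openin T U" "x \<in> U" "countable (U \<inter> K n)" unfolding Q_def by blast
    have "openin (subtopology T (K n)) (U \<inter> K n)" using U by (auto simp: openin_subtopology)
    then obtain B where B: "B \<in> \<B>" "x \<in> B" "B \<subseteq> U \<inter> K n" using \<B>(2)[of "U \<inter> K n" x] U x by blast
    then have "countable B" using U countable_subset by blast
    then show "x \<in> (\<Union>B\<in>{B \<in> \<B>. countable B}. B)" using B by blast
  qed
  moreover have "countable (\<Union>B\<in>{B \<in> \<B>. countable B}. B)"
    using \<B>(1) by (intro countable_UN) (auto intro: countable_subset[of _ \<B>])
  ultimately have cnt: "countable (K n - Q)" using countable_subset by blast
  have "\<exists>y\<in>Q. y \<in> U \<and> y \<noteq> x" if x: "x \<in> Q" "openin T U" "x \<in> U" for x U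
  proof (rule ccontr)
    assume "\<not> ?thesis"
    then have "U \<inter> K n \<subseteq> insert x (K n - Q)" by blast
    then have "countable (U \<inter> K n)" using cnt countable_insert countable_subset by metis
    then show False using x unfolding Q_def by blast
  qed
  note perfect = this
  have "\<exists>W. openin T W \<and> y \<in> W \<and> W \<subseteq> topspace T - Q" if y: "y \<in> topspace T - Q" for y
  proof (cases "y \<in> K n")
    case True
    then obtain U where "openin T U" "y \<in> U" "countable (U \<inter> K n)" using y unfolding Q_def by blast
    moreover from this have "U \<subseteq> topspace T - Q" using openin_subset unfolding Q_def by blast
    ultimately show ?thesis by blast
  next
    case False
    then have "y \<in> topspace T - K n" "topspace T - K n \<subseteq> topspace T - Q" using y unfolding Q_def by auto
    moreover have "openin T (topspace T - K n)" using closed_K by blast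
    ultimately show ?thesis by blast
  qed
  then have "openin T (topspace T - Q)" using openin_subopen by blast
  moreover have QK: "Q \<subseteq> K n" unfolding Q_def by blast
  ultimately have "closedin T Q" using Kc topspace_eq unfolding closedin_def by blast
  then have Qcpt: "compactin T Q" using QK compact_K closed_compactin by blast
  have "Q \<noteq> {}" using n cnt by auto
  then obtain x0 where x0: "x0 \<in> Q" by blast
  have Qc: "Q \<subseteq> carrier G" using QK Kc by blast
  then have x0c: "x0 \<in> carrier G" using x0 by blast
  let ?P = "(\<lambda>x. inv x0 \<otimes> x) ` Q"
  show thesis
  proof
    show "compactin T ?P" using Qcpt x0c by (intro image_compactin[OF _ continuous_map_lmult]) auto
    have "\<one> = inv x0 \<otimes> x0" using x0c by simp
    then show "\<one> \<in> ?P" using x0 by (rule image_eqI)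
    fix x U assume x: "x \<in> ?P" "openin T U" "x \<in> U"
    then obtain q where q: "q \<in> Q" "x = inv x0 \<otimes> q" by blast
    have "openin T {y \<in> carrier G. inv x0 \<otimes> y \<in> U}" using x x0c openin_preimage_lmult by simp
    moreover have "q \<in> {y \<in> carrier G. inv x0 \<otimes> y \<in> U}" using q x Qc by auto
    ultimately obtain y where y: "y \<in> Q" "inv x0 \<otimes> y \<in> U" "y \<noteq> q" using perfect[OF q(1)] by blast
    then have "y \<in> carrier G" "q \<in> carrier G" using q Qc by auto
    then have "inv x0 \<otimes> y \<noteq> x" using y q x0c by simp
    then show "\<exists>y\<in>?P. y \<in> U \<and> y \<noteq> x" using y by blast
  qed
qed

text \<open>One sequence \<open>t n\<close> of the fan suffices. Each f in \<open>F\<close> is the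
  limit of \<open>f \<otimes> t n m\<close>, and these points are outside \<open>F\<close> because
  \<open>t n m\<close> is not in \<open>set_inv F <#> F\<close>. A neighbourhood of
  \<open>f \<otimes> t n m\<close> also contains \<open>g \<otimes> t n m\<close> for some other g
  in \<open>F\<close> near f, as \<open>F\<close>, a union of translates of \<open>P\<close>, is
  perfect; this is the second point.\<close>

lemma thick_extension_exists:
  assumes t: "fan t" and unc: "uncountable (carrier G)" and E: "compactin T E"
  obtains E' where "compactin T E'" "E \<subseteq> E'" "thick_complement (subtopology T E') E"
proof -
  obtain P where P: "compactin T P" "\<one> \<in> P"
    "\<And>x U. x \<in> P \<Longrightarrow> openin T U \<Longrightarrow> x \<in> U \<Longrightarrow> \<exists>y\<in>P. y \<in> U \<and> y \<noteq> x"
    by (rule perfect_compact_exists[OF unc]) (rule that)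
  have Ec: "E \<subseteq> carrier G" and Pc: "P \<subseteq> carrier G"
    using E P compactin_subset_topspace[of T] unfolding topspace_eq by blast+
  define F where "F = E <#> P"
  have F: "compactin T F" unfolding F_def using E P compactin_set_mult by blast
  have Fc: "F \<subseteq> carrier G" using F compactin_subset_topspace topspace_eq by blast
  have EF: "E \<subseteq> F"
  proof
    fix e assume e: "e \<in> E"
    then have "e \<otimes> \<one> \<in> F" unfolding F_def using P by (intro set_multI)
    then show "e \<in> F" using e Ec by auto
  qed
  have Fperf: "\<exists>y\<in>F. y \<in> U \<and> y \<noteq> x" if x: "x \<in> F" "openin T U" "x \<in> U" for x U
  proof -
    obtain e q where eq: "e \<in> E" "q \<in> P" "x = e \<otimes> q" using x unfolding F_def set_mult_def by blast
    have ec: "e \<in> carrier G" using eq Ec by blast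
    have "openin T {y \<in> carrier G. e \<otimes> y \<in> U}" using x ec openin_preimage_lmult by simp
    moreover have "q \<in> {y \<in> carrier G. e \<otimes> y \<in> U}" using eq x Pc by auto
    ultimately obtain y where y: "y \<in> P" "e \<otimes> y \<in> U" "y \<noteq> q" using P(3)[OF eq(2)] by blast
    then have "y \<in> carrier G" "q \<in> carrier G" using eq Pc by auto
    then have "e \<otimes> y \<noteq> x" using y eq ec by simp
    moreover have "e \<otimes> y \<in> F" unfolding F_def using eq y by (intro set_multI)
    ultimately show ?thesis using y by blast
  qed
  have "compactin T (set_inv F <#> F)" using F compactin_set_mult compactin_set_inv by blast
  then obtain n where n: "\<And>m. t n m \<notin> set_inv F <#> F" using t unfolding fan_def by blast
  have tn: "limitin T (t n) \<one> sequentially" "range (t n) \<subseteq> carrier G" using t unfolding fan_def by auto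
  define Q where "Q = insert \<one> (range (t n))"
  have Q: "compactin T Q" unfolding Q_def using compactin_insert_limit[OF tn] .
  have notF: "f \<otimes> t n m \<notin> F" if "f \<in> F" for f m
  proof
    assume "f \<otimes> t n m \<in> F"
    then have "inv f \<otimes> (f \<otimes> t n m) \<in> set_inv F <#> F" using that by (intro set_multI set_invI)
    moreover have "inv f \<otimes> (f \<otimes> t n m) = t n m"
      using that Fc tn(2) by (simp add: m_assoc[symmetric] subset_iff image_subset_iff)
    ultimately show False using n by simp
  qed
  show thesis
  proof
    show "compactin T (F <#> Q)" using F Q compactin_set_mult by blast
    have "f \<in> F <#> Q" if "f \<in> F" for f
    proof -
      have "f \<otimes> \<one> \<in> F <#> Q" using that by (intro set_multI) (auto simp: Q_def)
      then show ?thesis using that Fc by auto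
    qed
    then show "E \<subseteq> F <#> Q" using EF by blast
    show "thick_complement (subtopology T (F <#> Q)) E"
      unfolding thick_complement_def
    proof (intro allI impI)
      fix V assume V: "openin (subtopology T (F <#> Q)) V" "V \<noteq> {}"
      then obtain W where W: "openin T W" "V = W \<inter> (F <#> Q)" unfolding openin_subtopology by blast
      obtain x where x: "x \<in> V" using V by blast
      then obtain f q where fq: "f \<in> F" "q \<in> Q" "x = f \<otimes> q" using W unfolding set_mult_def by blast
      have fc: "f \<in> carrier G" using fq Fc by blast
      have "\<exists>m. f \<otimes> t n m \<in> W"
      proof (cases "q = \<one>")
        case True
        have "limitin T (\<lambda>m. f \<otimes> t n m) (f \<otimes> \<one>) sequentially"
          by (rule limitin_mult) (use tn fc in \<open>auto simp: topspace_eq\<close>)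
        moreover have "f \<otimes> \<one> \<in> W" using True fq x W by blast
        ultimately have "\<forall>\<^sub>F m in sequentially. f \<otimes> t n m \<in> W" using W unfolding limitin_def by blast
        then show ?thesis unfolding eventually_sequentially by blast
      next
        case False
        then obtain m where "q = t n m" using fq unfolding Q_def by blast
        then show ?thesis using fq x W by blast
      qed
      then obtain m where m: "f \<otimes> t n m \<in> W" by blast
      have tc: "t n m \<in> carrier G" using tn by blast
      have "openin T {y \<in> topspace T. y \<otimes> t n m \<in> W}"
        using openin_continuous_map_preimage[OF continuous_map_rmult[OF tc] W(1)] .
      moreover have "f \<in> {y \<in> topspace T. y \<otimes> t n m \<in> W}" using m fc topspace_eq by simp
      ultimately obtain g where g: "g \<in> F" "g \<otimes> t n m \<in> W" "g \<noteq> f" using Fperf[OF fq(1)] by blast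
      have ne: "f \<otimes> t n m \<noteq> g \<otimes> t n m" using g fc Fc tc by auto
      have "f \<otimes> t n m \<in> F <#> Q" "g \<otimes> t n m \<in> F <#> Q"
        using fq g by (auto intro!: set_multI simp: Q_def)
      then have "f \<otimes> t n m \<in> V - E" "g \<otimes> t n m \<in> V - E"
        using m g W EF notF fq(1) by blast+
      then show "\<exists>u v. u \<in> V - E \<and> v \<in> V - E \<and> u \<noteq> v" using ne by blast
    qed
  qed
qed

theorem exists_thick_tower:
  assumes t: "fan t" and unc: "uncountable (carrier G)" and punct: "punctiform T"
  shows "\<exists>X. thick_tower X \<and> T = direct_limit_topology X"
proof -
  \<comment> \<open>Each step also absorbs the piece \<open>K n\<close>, so the levels cover
    \<open>G\<close> and openness in all levels implies openness in all pieces. Thickness is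
    produced for \<open>C n \<union> K n\<close> and passes to the smaller set
    \<open>C n\<close>.\<close>
  have "\<exists>C. \<forall>n. (compactin T (C n) \<and> (n = 0 \<longrightarrow> C n = {\<one>})) \<and>
      (C n \<union> K n \<subseteq> C (Suc n) \<and> thick_complement (subtopology T (C (Suc n))) (C n))"
  proof (rule dependent_nat_choice)
    show "\<exists>C. compactin T C \<and> ((0::nat) = 0 \<longrightarrow> C = {\<one>})" by (auto simp: topspace_eq)
    fix C and n :: nat assume "compactin T C \<and> (n = 0 \<longrightarrow> C = {\<one>})"
    then have "compactin T (C \<union> K n)" using compact_K compactin_Un by blast
    then obtain C' where C': "compactin T C'" "C \<union> K n \<subseteq> C'"
      "thick_complement (subtopology T C') (C \<union> K n)"
      by (rule thick_extension_exists[OF t unc])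
    have "thick_complement (subtopology T C') C"
      unfolding thick_complement_def
    proof (intro allI impI)
      fix V assume "openin (subtopology T C') V" "V \<noteq> {}"
      then obtain u v where "u \<in> V - (C \<union> K n) \<and> v \<in> V - (C \<union> K n) \<and> u \<noteq> v"
        using C'(3) unfolding thick_complement_def by metis
      then show "\<exists>u v. u \<in> V - C \<and> v \<in> V - C \<and> u \<noteq> v" by blast
    qed
    with C' show "\<exists>C'. (compactin T C' \<and> (Suc n = 0 \<longrightarrow> C' = {\<one>})) \<and>
        (C \<union> K n \<subseteq> C' \<and> thick_complement (subtopology T C') C)" by auto
  qed
  then obtain C where C: "\<And>n. compactin T (C n)" "C 0 = {\<one>}" "\<And>n. C n \<union> K n \<subseteq> C (Suc n)"
    "\<And>n. thick_complement (subtopology T (C (Suc n))) (C n)" by blast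
  have Cc: "C n \<subseteq> carrier G" for n using compactin_subset_topspace[OF C(1)] topspace_eq by blast
  have tC: "topspace (subtopology T (C n)) = C n" for n using Cc[of n] topspace_eq by auto
  have "thick_tower (\<lambda>n. subtopology T (C n))"
    unfolding thick_tower_def tC
  proof (intro conjI allI)
    show "compact_zero_dim (subtopology T (C n))" for n
      by (rule punctiform_compact_zero_dim[OF punct C(1)])
    show "C n \<subseteq> C (Suc n)" for n using C(3) by blast
    then show "subtopology (subtopology T (C (Suc n))) (C n) = subtopology T (C n)" for n
      by (simp add: subtopology_subtopology inf_absorb2)
    show "thick_complement (subtopology T (C (Suc n))) (C n)" for n by (rule C(4))
    show "\<exists>x. C 0 = {x}" using C(2) by blast
  qed
  moreover have "T = direct_limit_topology (\<lambda>n. subtopology T (C n))"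
    unfolding topology_eq openin_direct_limit_topology tC
  proof (intro allI iffI conjI)
    fix U assume U: "openin T U"
    have "U \<subseteq> (\<Union>n. K n)" unfolding cover_K using openin_subset[OF U] topspace_eq by simp
    then show "U \<subseteq> (\<Union>n. C n)" using C(3) by blast
    show "openin (subtopology T (C n)) (U \<inter> C n)" for n using U by (auto simp: openin_subtopology)
  next
    fix U assume U: "U \<subseteq> (\<Union>n. C n) \<and> (\<forall>n. openin (subtopology T (C n)) (U \<inter> C n))"
    show "openin T U"
    proof (rule openin_K)
      show "U \<subseteq> carrier G" using U Cc by blast
      fix n
      obtain W where W: "openin T W" "U \<inter> C (Suc n) = W \<inter> C (Suc n)"
        using U unfolding openin_subtopology by blast
      then have "U \<inter> K n = W \<inter> K n" using C(3)[of n] by blast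
      then show "openin (subtopology T (K n)) (U \<inter> K n)" using W(1) by (auto simp: openin_subtopology)
    qed
  qed
  ultimately show ?thesis by blast
qed

end

section \<open>From the hypotheses to the theorem\<close>

lemma M_omega_group_imp_locale:
  fixes G (structure)
  assumes "M_omega_group G T"
  obtains K where "M_omega_t1_group G T K"
proof -
  have tg: "group G" "topspace T = carrier G"
    "continuous_map (prod_topology T T) T (\<lambda>(x, y). x \<otimes> y)" "continuous_map T T (\<lambda>x. inv x)"
    using assms unfolding M_omega_group_def topological_group_def by auto
  interpret group G by (rule tg)
  obtain \<K> where \<K>: "countable \<K>" "\<Union>\<K> = topspace T"
    "\<And>K. K \<in> \<K> \<Longrightarrow> closedin T K" "\<And>K. K \<in> \<K> \<Longrightarrow> metrizable_space (subtopology T K)"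
    "\<And>U. U \<subseteq> topspace T \<Longrightarrow> openin T U \<longleftrightarrow> (\<forall>K\<in>\<K>. openin (subtopology T K) (U \<inter> K))"
    using assms unfolding M_omega_group_def M_omega_space_def by metis
  have "\<K> \<noteq> {}" using \<K>(2) tg(2) by auto
  then have range: "range (from_nat_into \<K>) = \<K>" using \<K>(1) by (rule range_from_nat_into)
  then have in\<K>: "from_nat_into \<K> n \<in> \<K>" for n by blast
  \<comment> \<open>A point is closed in the metrizable piece containing it, and the piece is closed
    in \<open>G\<close>.\<close>
  have "t1_space T"
    unfolding t1_space_closedin_singleton
  proof
    fix x assume "x \<in> topspace T"
    then obtain K where K: "K \<in> \<K>" "x \<in> K" using \<K>(2) by blast
    have "x \<in> topspace (subtopology T K)" using K \<K>(2) by auto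
    then have "closedin (subtopology T K) {x}"
      using metrizable_imp_t1_space[OF \<K>(4)[OF K(1)]] by (simp add: t1_space_closedin_singleton)
    then show "closedin T {x}" using \<K>(3)[OF K(1)] closedin_trans_full by blast
  qed
  have "M_omega_t1_group G T (from_nat_into \<K>)"
  proof unfold_locales
    show "t1_space T" by fact
    show "closedin T (from_nat_into \<K> n)" "metrizable_space (subtopology T (from_nat_into \<K> n))" for n
      using \<K>(3,4) in\<K> by auto
    show "(\<Union>n. from_nat_into \<K> n) = carrier G" using range \<K>(2) tg(2) by simp
    fix U assume Uc: "U \<subseteq> carrier G"
      and U: "\<And>n. openin (subtopology T (from_nat_into \<K> n)) (U \<inter> from_nat_into \<K> n)"
    have "openin (subtopology T K) (U \<inter> K)" if K: "K \<in> \<K>" for K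
    proof -
      obtain n where "K = from_nat_into \<K> n" using K range by blast
      then show ?thesis using U by simp
    qed
    then show "openin T U" using \<K>(5)[of U] Uc tg(2) by simp
  qed (use tg in auto)
  then show thesis by (rule that)
qed

theorem mainTheorem2:
  fixes G :: "('a, 'b) monoid_scheme" and T :: "'a topology" and p :: "nat \<Rightarrow> bool"
  assumes "M_omega_group G T"
    and "\<not> metrizable_space T"
    and "uncountable (topspace T)"
    and "separable_space T"
    and "punctiform T"
  shows "T homeomorphic_space cantor_power_limit p"
proof -
  obtain K where K: "M_omega_t1_group G T K"
    using assms(1) by (rule M_omega_group_imp_locale)
  interpret M_omega_t1_group G T K by (rule K)
  obtain t where t: "fan t" using fan_exists assms by blast
  obtain C where C: "k_omega_t1_group G T C"
    by (rule locally_compact_imp_k_omega[OF assms(4) fan_imp_locally_compact[OF t]])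
  interpret C: k_omega_t1_group G T C by (rule C)
  \<comment> \<open>The notion of fan refers to the group and its topology but not to the pieces, so
    it survives the replacement of \<open>K\<close> by \<open>C\<close>.\<close>
  have "C.fan t" using t by (simp add: fan_def C.fan_def)
  moreover have "uncountable (carrier G)" using assms(3) topspace_eq by simp
  ultimately obtain X where X: "thick_tower X" "T = direct_limit_topology X"
    using C.exists_thick_tower assms(5) by blast
  show ?thesis
    unfolding X(2) cantor_power_limit_eq
    by (rule thick_tower_direct_limits_homeomorphic[OF X(1) thick_tower_cantor_power])
qed

end
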